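(* Let $A$ and $B$ be separable simple unital $C^*$-algebras and assume that there exists a unital tracially sequentially-split $*$-homomorphism $\phi:A\to B$. If $B$ has real rank zero, then so does $A$.
   Context: For a $C^*$-algebra $A$, let $A^+$ be its cone of positive elements (including $0$), $c_0(\mathbb{N},A)=\{(a_n)_n: \lim_n\|a_n\|=0\}$, $l^\infty(\mathbb{N},A)=\{(a_n)_n: (\|a_n\|)_n \text{ bounded}\}$, and $A_\infty=l^\infty(\mathbb{N},A)/c_0(\mathbb{N},A)$. $A$ is embedded in $A_\infty$ as constant sequences, and $A_\infty\cap A'$ is the central sequence algebra. Let $A_\infty^{++}$ be the set of $x\in A_\infty^+$, $x=[(x_n)_n]$, for which there is no strictly increasing sequence $(k_n)$ of natural numbers with $\lim_n x_{k_n}=0$. Definition. Let $A,B$ be separable $C^*$-algebras with $A$ unital. A $*$-homomorphism $\phi:A\to B$ is tracially sequentially-split if for every nonzero $z\in A_\infty^{++}$ there exist a $*$-homomorphism $\psi:B\to A_\infty$ and a nonzero projection $g\in A_\infty\cap A'$ such that (1) $\psi(\phi(a))=ag$ for each $a\in A$, and (2) $1_{A_\infty}-g$ is Murray-von Neumann equivalent in $A_\infty$ to a projection in the hereditary $C^*$-subalgebra $\overline{zA_\infty z}$. A unital $C^*$-algebra has real rank zero if its invertible self-adjoint elements are dense in the set of its self-adjoint elements. *)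

theory Defs
  imports "HOL-Analysis.Analysis"
begin

section \<open>C*-algebras\<close>

text \<open>The underlying real normed algebra and the complex scalar multiplication are tied together
  by \<open>scaleC_of_real\<close>.  No unit is required.\<close>

class cstar_algebra = real_normed_algebra + banach +
  fixes scaleC :: "complex \<Rightarrow> 'a \<Rightarrow> 'a"
    and star :: "'a \<Rightarrow> 'a"
  assumes scaleC_add_right: "scaleC c (x + y) = scaleC c x + scaleC c y"
    and scaleC_add_left: "scaleC (c + d) x = scaleC c x + scaleC d x"
    and scaleC_scaleC: "scaleC c (scaleC d x) = scaleC (c * d) x"
    and scaleC_of_real: "scaleC (complex_of_real r) x = scaleR r x"
    and mult_scaleC_left: "scaleC c x * y = scaleC c (x * y)"
    and mult_scaleC_right: "x * scaleC c y = scaleC c (x * y)"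
    and norm_scaleC: "norm (scaleC c x) = cmod c * norm x"
    and star_star: "star (star x) = x"
    and star_add: "star (x + y) = star x + star y"
    and star_scaleC: "star (scaleC c x) = scaleC (cnj c) (star x)"
    and star_mult: "star (x * y) = star y * star x"
    and cstar_identity: "norm (star x * x) = (norm x)\<^sup>2"

text \<open>Unital C*-algebras; \<^class>\<open>real_normed_algebra_1\<close> excludes the zero algebra.\<close>

class unital_cstar_algebra = cstar_algebra + real_normed_algebra_1

lemma star_scaleR: "star (scaleR r x) = scaleR r (star x)" for x :: "'a::cstar_algebra"
  using star_scaleC[of "complex_of_real r" x] by (simp add: scaleC_of_real)

lemma star_minus: "star (- x) = - star x" for x :: "'a::cstar_algebra"
  using star_scaleR[of "-1" x] by simp

lemma star_zero: "star (0 :: 'a::cstar_algebra) = 0"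
  using star_scaleR[of 0 "0 :: 'a"] by simp

lemma star_diff: "star (x - y) = star x - star y" for x :: "'a::cstar_algebra"
  using star_add[of x "- y"] by (simp add: star_minus)

lemma norm_le_norm_star: "norm x \<le> norm (star x)" for x :: "'a::cstar_algebra"
proof (cases "x = 0")
  case False
  have "(norm x)\<^sup>2 \<le> norm (star x) * norm x"
    using norm_mult_ineq[of "star x" x] by (simp add: cstar_identity)
  moreover have "norm x > 0" using False norm_ge_zero[of x] norm_eq_zero[of x] by linarith
  ultimately show ?thesis by (simp add: power2_eq_square)
qed simp

lemma norm_star: "norm (star x) = norm x" for x :: "'a::cstar_algebra"
  using norm_le_norm_star[of x] norm_le_norm_star[of "star x"] by (simp add: star_star)

lemma bounded_linear_star: "bounded_linear (star :: 'a::cstar_algebra \<Rightarrow> 'a)"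
  by (rule bounded_linear_intro[where K = 1]) (simp_all add: star_add star_scaleR norm_star)

lemma bounded_linear_scaleC: "bounded_linear (scaleC c :: 'a::cstar_algebra \<Rightarrow> 'a)"
proof (rule bounded_linear_intro[where K = "cmod c"])
  fix r and x :: 'a
  show "scaleC c (r *\<^sub>R x) = r *\<^sub>R scaleC c x"
    by (simp add: scaleC_of_real[symmetric] scaleC_scaleC mult.commute)
qed (simp_all add: scaleC_add_right norm_scaleC)

definition star_hom :: "('a::cstar_algebra \<Rightarrow> 'b::cstar_algebra) \<Rightarrow> bool"
  where "star_hom f \<longleftrightarrow>
    (\<forall>x y. f (x + y) = f x + f y) \<and> (\<forall>c x. f (scaleC c x) = scaleC c (f x)) \<and>
    (\<forall>x y. f (x * y) = f x * f y) \<and> (\<forall>x. f (star x) = star (f x))"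

definition self_adjoint :: "'a::cstar_algebra \<Rightarrow> bool"
  where "self_adjoint x \<longleftrightarrow> star x = x"

definition projection :: "'a::cstar_algebra \<Rightarrow> bool"
  where "projection p \<longleftrightarrow> self_adjoint p \<and> p * p = p"

definition mvn_equivalent :: "'a::cstar_algebra \<Rightarrow> 'a \<Rightarrow> bool"
  where "mvn_equivalent p q \<longleftrightarrow> (\<exists>v. star v * v = p \<and> v * star v = q)"

text \<open>Positivity in the form that needs no unit (hence no spectrum).\<close>

definition positive_cone :: "'a::cstar_algebra set"
  where "positive_cone = {star y * y | y. True}"

definition hereditary_subalgebra :: "'a::cstar_algebra \<Rightarrow> 'a set"
  where "hereditary_subalgebra z = closure {z * x * z | x. True}"

definition closed_ideal :: "'a::cstar_algebra set \<Rightarrow> bool"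
  where "closed_ideal I \<longleftrightarrow> closed I \<and> 0 \<in> I \<and> (\<forall>x\<in>I. \<forall>y\<in>I. x + y \<in> I) \<and>
    (\<forall>c. \<forall>x\<in>I. scaleC c x \<in> I) \<and> (\<forall>a. \<forall>x\<in>I. a * x \<in> I \<and> x * a \<in> I)"

definition simple_cstar :: "'a::cstar_algebra itself \<Rightarrow> bool"
  where "simple_cstar _ \<longleftrightarrow> (\<exists>x::'a. x \<noteq> 0) \<and>
    (\<forall>I::'a set. closed_ideal I \<longrightarrow> I = {0} \<or> I = UNIV)"

definition separable_cstar :: "'a::cstar_algebra itself \<Rightarrow> bool"
  where "separable_cstar _ \<longleftrightarrow> separable_space (euclidean :: 'a topology)"

definition invertible_element :: "'a::unital_cstar_algebra \<Rightarrow> bool"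
  where "invertible_element x \<longleftrightarrow> (\<exists>y. x * y = 1 \<and> y * x = 1)"

definition real_rank_zero :: "'a::unital_cstar_algebra itself \<Rightarrow> bool"
  where "real_rank_zero _ \<longleftrightarrow>
    {x::'a. self_adjoint x} \<subseteq> closure {x. self_adjoint x \<and> invertible_element x}"


section \<open>Bounded sequences\<close>

text \<open>Since every function on \<^typ>\<open>nat\<close> is continuous, \<open>(nat, 'a) bcontfun\<close> with its supremum norm is
  the Banach space of bounded sequences.  Here it is made into a C*-algebra with pointwise
  operations.\<close>

text \<open>The library has this instance for metric domains only, which excludes \<^typ>\<open>nat\<close>.\<close>

instance bcontfun :: (topological_space, complete_space) complete_space
proof
  fix f :: "nat \<Rightarrow> ('a, 'b) bcontfun"
  assume "Cauchy f"
  then obtain g where "uniform_limit UNIV (\<lambda>n. apply_bcontfun (f n)) g sequentially"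
    using uniformly_convergent_eq_cauchy[of "\<lambda>_. True" "\<lambda>n. apply_bcontfun (f n)"]
    unfolding Cauchy_def uniform_limit_sequentially_iff
    by (metis dist_fun_lt_imp_dist_val_lt)
  from uniform_limit_bcontfunE[OF this sequentially_bot]
  obtain l where "g = apply_bcontfun l" "f \<longlonglongrightarrow> l" by metis
  then show "convergent f" by (intro convergentI)
qed

instance bcontfun :: (topological_space, banach) banach ..

lemma bcontfun_bounded_imageI:
  fixes f :: "('a::topological_space, 'b::real_normed_vector) bcontfun"
  assumes "bounded_linear h"
  shows "(\<lambda>x. h (apply_bcontfun f x)) \<in> bcontfun"
proof -
  have "bounded (h ` range (apply_bcontfun f))"
    by (rule bounded_linear_image[OF bounded_apply_bcontfun assms])
  then show ?thesis
    by (auto simp: bcontfun_def image_image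
        intro!: bounded_linear.continuous_on[OF assms] continuous_on_apply_bcontfun)
qed

instantiation bcontfun :: (topological_space, real_normed_algebra) real_normed_algebra
begin

definition times_bcontfun :: "('a, 'b) bcontfun \<Rightarrow> ('a, 'b) bcontfun \<Rightarrow> ('a, 'b) bcontfun"
  where "f * g = Bcontfun (\<lambda>x. apply_bcontfun f x * apply_bcontfun g x)"

lemma norm_apply_mult_le:
  fixes f g :: "('a, 'b) bcontfun"
  shows "norm (apply_bcontfun f x * apply_bcontfun g x) \<le> norm f * norm g"
  by (rule order_trans[OF norm_mult_ineq]) (intro mult_mono norm_bounded norm_ge_zero)

lemma apply_bcontfun_times [simp]:
  "apply_bcontfun (f * g) x = apply_bcontfun f x * apply_bcontfun g x"
  for f g :: "('a, 'b) bcontfun"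
proof -
  have "(\<lambda>x. apply_bcontfun f x * apply_bcontfun g x) \<in> bcontfun"
    by (rule bcontfun_normI[OF _ norm_apply_mult_le]) (intro continuous_intros; simp)
  then show ?thesis by (simp add: times_bcontfun_def Bcontfun_inverse)
qed

instance
  by standard (auto intro!: bcontfun_eqI norm_bound norm_apply_mult_le simp: algebra_simps)

end

instantiation bcontfun :: (topological_space, cstar_algebra) cstar_algebra
begin

definition scaleC_bcontfun :: "complex \<Rightarrow> ('a, 'b) bcontfun \<Rightarrow> ('a, 'b) bcontfun"
  where "scaleC c f = Bcontfun (\<lambda>x. scaleC c (apply_bcontfun f x))"

definition star_bcontfun :: "('a, 'b) bcontfun \<Rightarrow> ('a, 'b) bcontfun"
  where "star f = Bcontfun (\<lambda>x. star (apply_bcontfun f x))"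

lemma apply_bcontfun_scaleC [simp]:
  "apply_bcontfun (scaleC c f) x = scaleC c (apply_bcontfun f x)" for f :: "('a, 'b) bcontfun"
  by (simp add: scaleC_bcontfun_def Bcontfun_inverse bcontfun_bounded_imageI bounded_linear_scaleC)

lemma apply_bcontfun_star [simp]:
  "apply_bcontfun (star f) x = star (apply_bcontfun f x)" for f :: "('a, 'b) bcontfun"
  by (simp add: star_bcontfun_def Bcontfun_inverse bcontfun_bounded_imageI bounded_linear_star)

instance
proof
  fix c d :: complex and r :: real and f g :: "('a, 'b) bcontfun"
  show "scaleC c (f + g) = scaleC c f + scaleC c g"
    "scaleC (c + d) f = scaleC c f + scaleC d f"
    "scaleC c (scaleC d f) = scaleC (c * d) f"
    "scaleC (complex_of_real r) f = r *\<^sub>R f"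
    "scaleC c f * g = scaleC c (f * g)"
    "f * scaleC c g = scaleC c (f * g)"
    "star (star f) = f" "star (f + g) = star f + star g"
    "star (scaleC c f) = scaleC (cnj c) (star f)" "star (f * g) = star g * star f"
    by (auto intro!: bcontfun_eqI simp: scaleC_add_right scaleC_add_left scaleC_scaleC
        scaleC_of_real mult_scaleC_left mult_scaleC_right star_star star_add star_scaleC star_mult)
  have le: "norm (scaleC c h) \<le> cmod c * norm h" for c and h :: "('a, 'b) bcontfun"
    by (rule norm_bound) (simp add: norm_scaleC mult_left_mono norm_bounded)
  show "norm (scaleC c f) = cmod c * norm f"
  proof (cases "c = 0")
    case True
    then show ?thesis using le[of c f] norm_ge_zero[of "scaleC c f"] by simp
  next
    case False
    have "scaleC (inverse c) (scaleC c f) = f"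
      using False scaleC_of_real[of 1, where 'a = 'b]
      by (auto intro!: bcontfun_eqI simp: scaleC_scaleC)
    then have "norm f \<le> norm (scaleC c f) / cmod c"
      using le[of "inverse c" "scaleC c f"] by (simp add: norm_inverse divide_inverse mult.commute)
    then show ?thesis using le[of c f] False by (simp add: field_simps)
  qed
  show "norm (star f * f) = (norm f)\<^sup>2"
  proof (rule antisym)
    have "norm (star f) \<le> norm f" by (rule norm_bound) (simp add: norm_star norm_bounded)
    then show "norm (star f * f) \<le> (norm f)\<^sup>2"
      unfolding power2_eq_square by (meson norm_mult_ineq mult_right_mono norm_ge_zero order_trans)
    have "norm f \<le> sqrt (norm (star f * f))"
    proof (rule norm_bound)
      fix x
      have "(norm (apply_bcontfun f x))\<^sup>2 \<le> norm (star f * f)"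
        using norm_bounded[of "star f * f" x] by (simp add: cstar_identity)
      then show "norm (apply_bcontfun f x) \<le> sqrt (norm (star f * f))" by (rule real_le_rsqrt)
    qed
    from power_mono[OF this, of 2] show "(norm f)\<^sup>2 \<le> norm (star f * f)" by simp
  qed
qed

end

instantiation bcontfun :: (topological_space, real_normed_algebra_1) real_normed_algebra_1
begin

definition one_bcontfun :: "('a, 'b) bcontfun"
  where "1 = const_bcontfun 1"

lemma apply_bcontfun_one [simp]: "apply_bcontfun (1 :: ('a, 'b) bcontfun) x = 1"
  by (simp add: one_bcontfun_def)

instance
proof
  show "(0 :: ('a, 'b) bcontfun) \<noteq> 1"
    using zero_bcontfun.rep_eq apply_bcontfun_one zero_neq_one by metis
  show "norm (1 :: ('a, 'b) bcontfun) = 1"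
  proof (rule antisym)
    show "norm (1 :: ('a, 'b) bcontfun) \<le> 1" by (rule norm_bound) simp
    show "1 \<le> norm (1 :: ('a, 'b) bcontfun)"
      using norm_bounded[of "1 :: ('a, 'b) bcontfun"] by simp
  qed
qed (auto intro!: bcontfun_eqI)

end

instance bcontfun :: (topological_space, unital_cstar_algebra) unital_cstar_algebra ..


section \<open>The algebra of bounded sequences modulo null sequences\<close>

definition null_seqs :: "(nat, 'a::cstar_algebra) bcontfun set"
  where "null_seqs = {X. apply_bcontfun X \<longlonglongrightarrow> 0}"

lemma null_seqs_iff: "X \<in> null_seqs \<longleftrightarrow> apply_bcontfun X \<longlonglongrightarrow> 0"
  by (simp add: null_seqs_def)

lemma null_seqs_zero: "0 \<in> null_seqs"
  by (simp add: null_seqs_iff zero_bcontfun.rep_eq[abs_def])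

lemma null_seqs_linear:
  assumes "bounded_linear h" "X \<in> null_seqs" "\<And>n. apply_bcontfun Y n = h (apply_bcontfun X n)"
  shows "Y \<in> null_seqs"
proof -
  have "(\<lambda>n. h (apply_bcontfun X n)) \<longlonglongrightarrow> h 0"
    using assms(2) by (intro bounded_linear.tendsto[OF assms(1)]) (simp add: null_seqs_iff)
  moreover have "apply_bcontfun Y = (\<lambda>n. h (apply_bcontfun X n))" using assms(3) by auto
  ultimately show ?thesis
    by (simp add: null_seqs_iff linear_0[OF bounded_linear.linear[OF assms(1)]])
qed

lemma null_seqs_add: "X \<in> null_seqs \<Longrightarrow> Y \<in> null_seqs \<Longrightarrow> X + Y \<in> null_seqs"
  using tendsto_add[of "apply_bcontfun X" 0 sequentially "apply_bcontfun Y" 0]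
  by (simp add: null_seqs_iff plus_bcontfun.rep_eq[abs_def])

lemma null_seqs_uminus: "X \<in> null_seqs \<Longrightarrow> - X \<in> null_seqs"
  by (rule null_seqs_linear[OF bounded_linear_minus[OF bounded_linear_ident]]) auto

lemma null_seqs_diff: "X \<in> null_seqs \<Longrightarrow> Y \<in> null_seqs \<Longrightarrow> X - Y \<in> null_seqs"
  using null_seqs_add[OF _ null_seqs_uminus, of X Y] by simp

lemma null_seqs_scaleR: "X \<in> null_seqs \<Longrightarrow> r *\<^sub>R X \<in> null_seqs"
  by (rule null_seqs_linear[OF bounded_linear_scaleR_right]) auto

lemma null_seqs_scaleC: "X \<in> null_seqs \<Longrightarrow> scaleC c X \<in> null_seqs"
  by (rule null_seqs_linear[OF bounded_linear_scaleC]) auto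

lemma null_seqs_star: "X \<in> null_seqs \<Longrightarrow> star X \<in> null_seqs"
  by (rule null_seqs_linear[OF bounded_linear_star]) auto

lemma null_seqs_dominated:
  assumes "X \<in> null_seqs" "\<And>n. norm (apply_bcontfun Y n) \<le> norm (apply_bcontfun X n) * K"
  shows "Y \<in> null_seqs"
  using tendsto_0_le[OF _ always_eventually[OF allI[OF assms(2)]]] assms(1)
  unfolding null_seqs_iff .

lemma null_seqs_mult_right:
  assumes "X \<in> null_seqs"
  shows "X * Y \<in> null_seqs"
proof (rule null_seqs_dominated[OF assms])
  fix n
  have "norm (apply_bcontfun (X * Y) n) \<le> norm (apply_bcontfun X n) * norm (apply_bcontfun Y n)"
    by (simp add: norm_mult_ineq)
  also have "\<dots> \<le> norm (apply_bcontfun X n) * norm Y"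
    by (intro mult_left_mono norm_bounded norm_ge_zero)
  finally show "norm (apply_bcontfun (X * Y) n) \<le> norm (apply_bcontfun X n) * norm Y" .
qed

lemma null_seqs_mult_left:
  assumes "X \<in> null_seqs"
  shows "Y * X \<in> null_seqs"
proof (rule null_seqs_dominated[OF assms])
  fix n
  have "norm (apply_bcontfun (Y * X) n) \<le> norm (apply_bcontfun Y n) * norm (apply_bcontfun X n)"
    by (simp add: norm_mult_ineq)
  also have "\<dots> \<le> norm Y * norm (apply_bcontfun X n)"
    by (intro mult_right_mono norm_bounded norm_ge_zero)
  finally show "norm (apply_bcontfun (Y * X) n) \<le> norm (apply_bcontfun X n) * norm Y"
    by (simp add: mult.commute)
qed

text \<open>\<open>'a ainf\<close> is the quotient of the bounded by the null sequences, with \<open>seq_class\<close> as the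
  quotient map.\<close>

quotient_type (overloaded) 'a ainf = "(nat, 'a::cstar_algebra) bcontfun" / "\<lambda>X Y. X - Y \<in> null_seqs"
  morphisms rep_ainf seq_class
proof (rule equivpI)
  show "reflp (\<lambda>X Y :: (nat, 'a) bcontfun. X - Y \<in> null_seqs)"
    by (simp add: reflp_def null_seqs_zero)
  show "symp (\<lambda>X Y :: (nat, 'a) bcontfun. X - Y \<in> null_seqs)"
    using null_seqs_uminus by (fastforce simp: symp_def)
  show "transp (\<lambda>X Y :: (nat, 'a) bcontfun. X - Y \<in> null_seqs)"
    using null_seqs_add by (fastforce simp: transp_def)
qed

lemma seq_class_eq_iff: "seq_class X = seq_class Y \<longleftrightarrow> X - Y \<in> null_seqs"
  by (rule ainf.abs_eq_iff)

lemma ainf_cases: obtains X where "x = seq_class X"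
  by (induct x rule: ainf.abs_induct) blast

instantiation ainf :: (cstar_algebra) real_algebra
begin

lift_definition zero_ainf :: "'a ainf" is 0 .

lift_definition plus_ainf :: "'a ainf \<Rightarrow> 'a ainf \<Rightarrow> 'a ainf" is "(+)"
  by (metis add_diff_add null_seqs_add)

lift_definition uminus_ainf :: "'a ainf \<Rightarrow> 'a ainf" is uminus
  by (metis minus_diff_minus null_seqs_uminus)

lift_definition minus_ainf :: "'a ainf \<Rightarrow> 'a ainf \<Rightarrow> 'a ainf" is "(-)"
proof -
  fix X X' Y Y' :: "(nat, 'a) bcontfun"
  assume "X - X' \<in> null_seqs" "Y - Y' \<in> null_seqs"
  then have "(X - X') - (Y - Y') \<in> null_seqs" by (rule null_seqs_diff)
  then show "(X - Y) - (X' - Y') \<in> null_seqs" by (simp add: algebra_simps)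
qed

lift_definition times_ainf :: "'a ainf \<Rightarrow> 'a ainf \<Rightarrow> 'a ainf" is "(*)"
proof -
  fix X X' Y Y' :: "(nat, 'a) bcontfun"
  assume "X - X' \<in> null_seqs" "Y - Y' \<in> null_seqs"
  then have "(X - X') * Y + X' * (Y - Y') \<in> null_seqs"
    by (intro null_seqs_add null_seqs_mult_left null_seqs_mult_right)
  then show "X * Y - X' * Y' \<in> null_seqs" by (simp add: algebra_simps)
qed

lift_definition scaleR_ainf :: "real \<Rightarrow> 'a ainf \<Rightarrow> 'a ainf" is scaleR
  by (metis null_seqs_scaleR scaleR_diff_right)

instance
  by standard (transfer, simp add: algebra_simps null_seqs_zero)+

end

lemmas seq_class_simps =
  zero_ainf.abs_eq plus_ainf.abs_eq uminus_ainf.abs_eq minus_ainf.abs_eq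
  times_ainf.abs_eq scaleR_ainf.abs_eq

instantiation ainf :: (cstar_algebra) real_normed_vector
begin

text \<open>The quotient norm: the distance from a representative to the ideal of null sequences.\<close>

lift_definition norm_ainf :: "'a ainf \<Rightarrow> real" is "\<lambda>X. infdist X null_seqs"
proof -
  have le: "infdist X null_seqs \<le> infdist Y null_seqs"
    if "X - Y \<in> null_seqs" for X Y :: "(nat, 'a) bcontfun"
  proof -
    have "infdist X null_seqs \<le> dist Y C" if C: "C \<in> null_seqs" for C
    proof -
      have "C + (X - Y) \<in> null_seqs" using C \<open>X - Y \<in> null_seqs\<close> by (rule null_seqs_add)
      then have "infdist X null_seqs \<le> dist X (C + (X - Y))" by (rule infdist_le)
      then show ?thesis by (simp add: dist_norm algebra_simps)
    qed
    then show ?thesis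
      unfolding infdist_def[of Y] using null_seqs_zero by (auto intro: cINF_greatest)
  qed
  fix X Y :: "(nat, 'a) bcontfun"
  assume "X - Y \<in> null_seqs"
  moreover from null_seqs_uminus[OF this] have "Y - X \<in> null_seqs" by simp
  ultimately show "infdist X null_seqs = infdist Y null_seqs" using le by (blast intro: antisym)
qed

definition dist_ainf :: "'a ainf \<Rightarrow> 'a ainf \<Rightarrow> real"
  where "dist_ainf x y = norm (x - y)"

definition sgn_ainf :: "'a ainf \<Rightarrow> 'a ainf"
  where "sgn_ainf x = x /\<^sub>R norm x"

definition uniformity_ainf :: "('a ainf \<times> 'a ainf) filter"
  where "uniformity_ainf = (INF e\<in>{0 <..}. principal {(x, y). dist x y < e})"

definition open_ainf :: "'a ainf set \<Rightarrow> bool"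
  where "open_ainf S = (\<forall>x\<in>S. \<forall>\<^sub>F (x', y) in uniformity. x' = x \<longrightarrow> y \<in> S)"

lemma norm_seq_class_le: "norm (seq_class X) \<le> norm X" for X :: "(nat, 'a) bcontfun"
  using infdist_le[OF null_seqs_zero, of X] by (simp add: norm_ainf.abs_eq)

lemma norm_ainf_less_obtain:
  fixes x :: "'a ainf"
  assumes "norm x < r"
  obtains X where "x = seq_class X" "norm X < r"
proof -
  obtain X where X: "x = seq_class X" by (rule ainf_cases)
  have "(INF C\<in>null_seqs. dist X C) < r"
    using assms null_seqs_zero by (auto simp: X norm_ainf.abs_eq infdist_def split: if_splits)
  then obtain C where "C \<in> null_seqs" "dist X C < r"
    using null_seqs_zero by (subst (asm) cINF_less_iff) (auto intro!: bdd_belowI2[of _ 0])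
  then have "x = seq_class (X - C)" "norm (X - C) < r"
    by (simp_all add: X seq_class_eq_iff dist_norm)
  then show thesis by (rule that)
qed

lemma norm_ainf_nonneg: "0 \<le> norm x" for x :: "'a ainf"
  by transfer (rule infdist_nonneg)

lemma eventually_norm_less:
  fixes X :: "(nat, 'a) bcontfun"
  assumes "norm (seq_class X) < r"
  shows "\<forall>\<^sub>F n in sequentially. norm (apply_bcontfun X n) < r"
proof -
  obtain Y where Y: "seq_class X = seq_class Y" "norm Y < r"
    using norm_ainf_less_obtain[OF assms] by blast
  then have "apply_bcontfun (X - Y) \<longlonglongrightarrow> 0" by (simp add: seq_class_eq_iff null_seqs_iff)
  from tendstoD[OF this, of "r - norm Y"] Y(2)
  have "\<forall>\<^sub>F n in sequentially. norm (apply_bcontfun X n - apply_bcontfun Y n) < r - norm Y"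
    by simp
  then show ?thesis
  proof eventually_elim
    case (elim n)
    then show ?case
      using norm_bounded[of Y n] norm_triangle_sub[of "apply_bcontfun X n" "apply_bcontfun Y n"]
      by linarith
  qed
qed

lemma norm_seq_class_leI:
  fixes X :: "(nat, 'a) bcontfun"
  assumes "\<forall>\<^sub>F n in sequentially. norm (apply_bcontfun X n) \<le> r"
  shows "norm (seq_class X) \<le> r"
proof -
  obtain N where N: "\<And>n. n \<ge> N \<Longrightarrow> norm (apply_bcontfun X n) \<le> r"
    using assms by (auto simp: eventually_sequentially)
  have r: "0 \<le> r" using N[of N] norm_ge_zero order_trans by blast
  define f where "f n = (if n < N then 0 else apply_bcontfun X n)" for n
  have f: "f \<in> bcontfun" by (rule bcontfun_normI[of _ r]) (use N r in \<open>auto simp: f_def\<close>)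
  have "apply_bcontfun (X - Bcontfun f) \<longlonglongrightarrow> 0"
    by (rule tendsto_eventually, rule eventually_sequentiallyI[of N])
      (simp add: f Bcontfun_inverse, simp add: f_def)
  then have "seq_class X = seq_class (Bcontfun f)" by (simp add: seq_class_eq_iff null_seqs_iff)
  moreover have "norm (Bcontfun f) \<le> r"
    by (rule norm_bound) (use N r f in \<open>auto simp: Bcontfun_inverse f_def\<close>)
  ultimately show ?thesis using norm_seq_class_le order_trans by metis
qed

instance
proof
  fix x y :: "'a ainf" and a :: real
  show "norm x = 0 \<longleftrightarrow> x = 0"
  proof
    obtain X where X: "x = seq_class X" by (rule ainf_cases)
    assume "norm x = 0"
    then have "apply_bcontfun X \<longlonglongrightarrow> 0"
      using eventually_norm_less[of X] by (auto simp: X tendsto_iff)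
    then show "x = 0" by (simp add: X zero_ainf.abs_eq seq_class_eq_iff null_seqs_iff)
  next
    assume "x = 0"
    then show "norm x = 0"
      using norm_seq_class_le[of 0] norm_ainf_nonneg[of x] by (simp add: zero_ainf.abs_eq)
  qed
  show "norm (x + y) \<le> norm x + norm y"
  proof (rule field_le_epsilon)
    fix e :: real assume "e > 0"
    obtain X where X: "x = seq_class X" "norm X < norm x + e / 2"
      using norm_ainf_less_obtain[of x "norm x + e / 2"] \<open>e > 0\<close> by auto
    obtain Y where Y: "y = seq_class Y" "norm Y < norm y + e / 2"
      using norm_ainf_less_obtain[of y "norm y + e / 2"] \<open>e > 0\<close> by auto
    have "norm (x + y) \<le> norm (X + Y)"
      by (simp add: X Y plus_ainf.abs_eq norm_seq_class_le)
    then show "norm (x + y) \<le> norm x + norm y + e"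
      using norm_triangle_ineq[of X Y] X(2) Y(2) by linarith
  qed
  have le: "norm (a *\<^sub>R x) \<le> \<bar>a\<bar> * norm x" for a and x :: "'a ainf"
  proof (rule field_le_epsilon)
    fix e :: real assume "e > 0"
    define d where "d = e / (\<bar>a\<bar> + 1)"
    have d: "d > 0" "\<bar>a\<bar> * d \<le> e" using \<open>e > 0\<close> by (auto simp: d_def field_simps)
    obtain X where X: "x = seq_class X" "norm X < norm x + d"
      using norm_ainf_less_obtain[of x "norm x + d"] d by auto
    have "norm (a *\<^sub>R x) \<le> \<bar>a\<bar> * norm X"
      using norm_seq_class_le[of "a *\<^sub>R X"] by (simp add: X scaleR_ainf.abs_eq)
    also have "\<dots> \<le> \<bar>a\<bar> * (norm x + d)" using X(2) by (intro mult_left_mono) auto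
    finally show "norm (a *\<^sub>R x) \<le> \<bar>a\<bar> * norm x + e" using d by (simp add: algebra_simps)
  qed
  show "norm (a *\<^sub>R x) = \<bar>a\<bar> * norm x"
  proof (cases "a = 0")
    case True
    then show ?thesis using le[of a x] norm_ainf_nonneg[of "a *\<^sub>R x"] by simp
  next
    case False
    then show ?thesis
      using le[of a x] le[of "inverse a" "a *\<^sub>R x"] by (simp add: field_simps)
  qed
qed (simp_all add: dist_ainf_def sgn_ainf_def uniformity_ainf_def open_ainf_def)

end

instance ainf :: (cstar_algebra) real_normed_algebra
proof
  fix x y :: "'a ainf"
  obtain X where X: "x = seq_class X" by (rule ainf_cases)
  obtain Y where Y: "y = seq_class Y" by (rule ainf_cases)
  have *: "norm (x * y) \<le> (norm x + e) * (norm y + e)" if "e > 0" for e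
  proof -
    have "\<forall>\<^sub>F n in sequentially. norm (apply_bcontfun X n) < norm x + e"
      by (rule eventually_norm_less) (simp add: X that)
    moreover have "\<forall>\<^sub>F n in sequentially. norm (apply_bcontfun Y n) < norm y + e"
      by (rule eventually_norm_less) (simp add: Y that)
    ultimately have "\<forall>\<^sub>F n in sequentially.
        norm (apply_bcontfun (X * Y) n) \<le> (norm x + e) * (norm y + e)"
    proof eventually_elim
      case (elim n)
      have "norm (apply_bcontfun (X * Y) n) \<le> norm (apply_bcontfun X n) * norm (apply_bcontfun Y n)"
        by (simp add: norm_mult_ineq)
      also have "\<dots> \<le> (norm x + e) * (norm y + e)" using elim that by (intro mult_mono) auto
      finally show ?case .
    qed
    then show ?thesis unfolding X Y times_ainf.abs_eq by (rule norm_seq_class_leI)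
  qed
  have "((\<lambda>e. (norm x + e) * (norm y + e)) \<longlongrightarrow> (norm x + 0) * (norm y + 0)) (at_right 0)"
    by (intro tendsto_intros)
  then show "norm (x * y) \<le> norm x * norm y"
    using * by (intro tendsto_lowerbound) (auto simp: eventually_at_right_less
      intro!: eventually_at_rightI[of 0 1])
qed

instance ainf :: (cstar_algebra) banach
proof
  fix S :: "nat \<Rightarrow> 'a ainf"
  assume S: "Cauchy S"
  have "\<exists>N. \<forall>m\<ge>N. \<forall>n\<ge>N. norm (S m - S n) < (1 / 2) ^ k" for k
    using CauchyD[OF S, of "(1 / 2) ^ k"] by simp
  then obtain N where N: "\<And>k m n. m \<ge> N k \<Longrightarrow> n \<ge> N k \<Longrightarrow> norm (S m - S n) < (1 / 2) ^ k"
    by metis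
  define r where "r k = (\<Sum>i\<le>k. Suc (N i))" for k
  have r_mono: "strict_mono r" by (simp add: strict_mono_Suc_iff r_def)
  have r_ge: "r k \<ge> N k" "r (Suc k) \<ge> N k" for k
    by (simp_all add: r_def sum.atMost_Suc[of _ k] lessThan_Suc_atMost[symmetric])
  have "\<exists>Y. S (r (Suc k)) - S (r k) = seq_class Y \<and> norm Y < (1 / 2) ^ k" for k
    using norm_ainf_less_obtain[OF N[OF r_ge(2,1)]] by metis
  then obtain Y where Y: "\<And>k. S (r (Suc k)) - S (r k) = seq_class (Y k)"
      "\<And>k. norm (Y k) < (1 / 2) ^ k"
    by metis
  have "summable (\<lambda>k. norm (Y k))"
    by (rule summable_comparison_test'[where g = "\<lambda>k. (1 / 2) ^ k" and N = 0])
      (auto intro: less_imp_le Y(2) summable_geometric)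
  then have "summable Y" by (rule summable_norm_cancel)
  then have lim: "(\<lambda>n. (\<Sum>k<n. Y k)) \<longlonglongrightarrow> suminf Y" by (rule summable_LIMSEQ)
  have part: "seq_class (\<Sum>k<n. Y k) = S (r n) - S (r 0)" for n
    by (induction n) (simp_all add: zero_ainf.abs_eq[symmetric] plus_ainf.abs_eq[symmetric] Y(1)[symmetric])
  have "(\<lambda>n. S (r n) - S (r 0)) \<longlonglongrightarrow> seq_class (suminf Y)"
  proof (rule Lim_transform_bound[OF _ lim[THEN LIM_zero], THEN LIM_zero_cancel])
    show "\<forall>\<^sub>F n in sequentially. norm (S (r n) - S (r 0) - seq_class (suminf Y))
        \<le> norm ((\<Sum>k<n. Y k) - suminf Y)"
      by (simp add: part[symmetric] minus_ainf.abs_eq norm_seq_class_le)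
  qed
  from tendsto_add[OF this tendsto_const[of "S (r 0)"]]
  have "(S \<circ> r) \<longlonglongrightarrow> seq_class (suminf Y) + S (r 0)" by (simp add: comp_def)
  with S r_mono show "convergent S"
    using Cauchy_converges_subseq convergentI by blast
qed

instantiation ainf :: (cstar_algebra) cstar_algebra
begin

lift_definition scaleC_ainf :: "complex \<Rightarrow> 'a ainf \<Rightarrow> 'a ainf" is scaleC
proof -
  fix c and X Y :: "(nat, 'a) bcontfun"
  assume "X - Y \<in> null_seqs"
  from null_seqs_scaleC[OF this, of c] show "scaleC c X - scaleC c Y \<in> null_seqs"
    by (simp add: linear_diff bounded_linear.linear[OF bounded_linear_scaleC])
qed

lift_definition star_ainf :: "'a ainf \<Rightarrow> 'a ainf" is star
  by (metis null_seqs_star star_diff)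

instance
proof
  fix c d :: complex and r :: real and x y :: "'a ainf"
  show "scaleC c (x + y) = scaleC c x + scaleC c y"
    by transfer (simp add: scaleC_add_right null_seqs_zero)
  show "scaleC (c + d) x = scaleC c x + scaleC d x"
    by transfer (simp add: scaleC_add_left null_seqs_zero)
  show "scaleC c (scaleC d x) = scaleC (c * d) x"
    by transfer (simp add: scaleC_scaleC null_seqs_zero)
  show "scaleC (complex_of_real r) x = r *\<^sub>R x"
    by transfer (simp add: scaleC_of_real null_seqs_zero)
  show "scaleC c x * y = scaleC c (x * y)"
    by transfer (simp add: mult_scaleC_left null_seqs_zero)
  show "x * scaleC c y = scaleC c (x * y)"
    by transfer (simp add: mult_scaleC_right null_seqs_zero)
  show "star (star x) = x" by transfer (simp add: star_star null_seqs_zero)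
  show "star (x + y) = star x + star y" by transfer (simp add: star_add null_seqs_zero)
  show "star (scaleC c x) = scaleC (cnj c) (star x)"
    by transfer (simp add: star_scaleC null_seqs_zero)
  show "star (x * y) = star y * star x" by transfer (simp add: star_mult null_seqs_zero)
  have le: "norm (scaleC c x) \<le> cmod c * norm x" for c and x :: "'a ainf"
  proof (rule field_le_epsilon)
    fix e :: real assume "e > 0"
    define d where "d = e / (cmod c + 1)"
    have "cmod c + 1 > 0" by (simp add: add_nonneg_pos)
    then have d: "d > 0" "cmod c * d \<le> e" using \<open>e > 0\<close> by (auto simp: d_def field_simps)
    obtain X where X: "x = seq_class X" "norm X < norm x + d"
      using norm_ainf_less_obtain[of x "norm x + d"] d by auto
    have "norm (scaleC c x) \<le> cmod c * norm X"
      using norm_seq_class_le[of "scaleC c X"] by (simp add: X scaleC_ainf.abs_eq norm_scaleC)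
    also have "\<dots> \<le> cmod c * (norm x + d)" using X(2) by (intro mult_left_mono) auto
    finally show "norm (scaleC c x) \<le> cmod c * norm x + e" using d by (simp add: algebra_simps)
  qed
  show "norm (scaleC c x) = cmod c * norm x"
  proof (cases "c = 0")
    case True
    then show ?thesis using le[of c x] by simp
  next
    case False
    have "scaleC (inverse c) (scaleC c x) = scaleC (complex_of_real 1) x"
      using False by transfer (simp add: scaleC_scaleC null_seqs_zero)
    also have "\<dots> = x" by transfer (simp add: scaleC_of_real null_seqs_zero del: of_real_1)
    finally have "norm x \<le> norm (scaleC c x) / cmod c"
      using le[of "inverse c" "scaleC c x"] by (simp add: norm_inverse divide_inverse mult.commute)
    then show ?thesis using le[of c x] False by (simp add: field_simps)
  qed
  show "norm (star x * x) = (norm x)\<^sup>2"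
  proof (rule antisym)
    have "norm (star x) \<le> norm x"
    proof (rule field_le_epsilon)
      fix e :: real assume "e > 0"
      then obtain X where X: "x = seq_class X" "norm X < norm x + e"
        using norm_ainf_less_obtain[of x "norm x + e"] by auto
      then show "norm (star x) \<le> norm x + e"
        using norm_seq_class_le[of "star X"] by (simp add: star_ainf.abs_eq norm_star)
    qed
    then show "norm (star x * x) \<le> (norm x)\<^sup>2"
      unfolding power2_eq_square by (meson norm_mult_ineq mult_right_mono norm_ge_zero order_trans)
    obtain X where X: "x = seq_class X" by (rule ainf_cases)
    show "(norm x)\<^sup>2 \<le> norm (star x * x)"
    proof (rule field_le_epsilon)
      fix e :: real assume "e > 0"
      have "\<forall>\<^sub>F n in sequentially. norm (apply_bcontfun (star X * X) n) < norm (star x * x) + e"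
        by (rule eventually_norm_less) (simp add: X star_ainf.abs_eq times_ainf.abs_eq \<open>e > 0\<close>)
      then have "\<forall>\<^sub>F n in sequentially. norm (apply_bcontfun X n) \<le> sqrt (norm (star x * x) + e)"
        by eventually_elim (simp add: cstar_identity real_le_rsqrt)
      then have "norm x \<le> sqrt (norm (star x * x) + e)" unfolding X by (rule norm_seq_class_leI)
      from power_mono[OF this, of 2] show "(norm x)\<^sup>2 \<le> norm (star x * x) + e"
        using \<open>e > 0\<close> by simp
    qed
  qed
qed

end

instantiation ainf :: (unital_cstar_algebra) real_normed_algebra_1
begin

lift_definition one_ainf :: "'a ainf" is 1 .

instance
proof
  fix x :: "'a ainf"
  show "1 * x = x" "x * 1 = x" by (transfer, simp add: null_seqs_zero)+
  have "1 \<le> norm (1 :: 'a ainf)"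
  proof (rule ccontr)
    assume "\<not> 1 \<le> norm (1 :: 'a ainf)"
    then have "\<forall>\<^sub>F n in sequentially. norm (apply_bcontfun (1 :: (nat, 'a) bcontfun) n) < 1"
      by (intro eventually_norm_less) (simp add: one_ainf.abs_eq)
    then show False by (simp add: trivial_limit_def[symmetric])
  qed
  moreover have "norm (1 :: 'a ainf) \<le> 1"
    using norm_seq_class_le[of "1 :: (nat, 'a) bcontfun"] by (simp add: one_ainf.abs_eq)
  ultimately show one: "norm (1 :: 'a ainf) = 1" by simp
  show "(0 :: 'a ainf) \<noteq> 1" using one norm_zero[where 'a = "'a ainf"] by (metis zero_neq_one)
qed

end

instance ainf :: (unital_cstar_algebra) unital_cstar_algebra ..

definition const_seq :: "'a::cstar_algebra \<Rightarrow> 'a ainf"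
  where "const_seq a = seq_class (const_bcontfun a)"

definition central_sequences :: "'a::cstar_algebra ainf set"
  where "central_sequences = {x. \<forall>a. x * const_seq a = const_seq a * x}"

text \<open>Lifting shows that the choice of the representing sequence does not matter.\<close>

lift_definition has_null_subseq :: "'a::cstar_algebra ainf \<Rightarrow> bool"
  is "\<lambda>X. \<exists>k::nat \<Rightarrow> nat. strict_mono k \<and> (\<lambda>n. apply_bcontfun X (k n)) \<longlonglongrightarrow> 0"
proof -
  fix X Y :: "(nat, 'a) bcontfun"
  assume "X - Y \<in> null_seqs"
  then have "(\<lambda>n. apply_bcontfun X (k n) - apply_bcontfun Y (k n)) \<longlonglongrightarrow> 0" if "strict_mono k" for k
    using LIMSEQ_subseq_LIMSEQ[OF _ that, of "apply_bcontfun (X - Y)" 0]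
    by (simp add: null_seqs_iff comp_def)
  from Lim_transform_eq[OF this]
  have "(\<lambda>n. apply_bcontfun X (k n)) \<longlonglongrightarrow> 0 \<longleftrightarrow> (\<lambda>n. apply_bcontfun Y (k n)) \<longlonglongrightarrow> 0"
    if "strict_mono k" for k
    using that .
  then show "(\<exists>k::nat \<Rightarrow> nat. strict_mono k \<and> (\<lambda>n. apply_bcontfun X (k n)) \<longlonglongrightarrow> 0) \<longleftrightarrow>
      (\<exists>k::nat \<Rightarrow> nat. strict_mono k \<and> (\<lambda>n. apply_bcontfun Y (k n)) \<longlonglongrightarrow> 0)"
    by blast
qed

definition ainf_pp :: "'a::cstar_algebra ainf set"
  where "ainf_pp = {x \<in> positive_cone. \<not> has_null_subseq x}"


section \<open>Tracially sequentially-split homomorphisms\<close>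

text \<open>Here \<open>\<psi>\<close> need not be unital (\<open>\<psi> (\<phi> 1) = g\<close>), and \<open>1\<close> is the unit of \<^typ>\<open>'a ainf\<close>.\<close>

definition tracially_sequentially_split ::
    "('a::unital_cstar_algebra \<Rightarrow> 'b::cstar_algebra) \<Rightarrow> bool"
  where "tracially_sequentially_split \<phi> \<longleftrightarrow>
    separable_cstar TYPE('a) \<and> separable_cstar TYPE('b) \<and> star_hom \<phi> \<and>
    (\<forall>z\<in>ainf_pp. z \<noteq> 0 \<longrightarrow>
      (\<exists>(\<psi> :: 'b \<Rightarrow> 'a ainf) g.
        star_hom \<psi> \<and> projection g \<and> g \<noteq> 0 \<and> g \<in> central_sequences \<and>
        (\<forall>a. \<psi> (\<phi> a) = const_seq a * g) \<and>
        (\<exists>p. projection p \<and> p \<in> hereditary_subalgebra z \<and> mvn_equivalent (1 - g) p)))"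

end

theory Submission
  imports Defs
begin

text \<open>By scaling it suffices to find, for every self-adjoint \<open>x\<close>, an invertible self-adjoint
  element at distance at most an absolute constant; so norm estimates may be crude.  If \<open>x\<close> is not
  invertible, a bounded perturbation achieves \<open>x z = 0\<close> for some \<open>z \<noteq> 0\<close>.  Real rank zero of the
  codomain yields an invertible \<open>k\<close> near \<open>\<phi> x\<close> with \<open>\<parallel>k\<^sup>-\<^sup>1\<parallel> \<le> 1\<close> that is close to the scalar 2
  wherever \<open>\<phi> x\<close> vanishes.

  The splitting is used twice.  The first one, lifted to finite stage, gives a projection \<open>p\<close> of the
  domain that almost commutes with \<open>x\<close>, and a \<open>c\<close> in the corner of \<open>p\<close> that plays the role of \<open>k\<close>.
  The second one, for an element \<open>t\<close> of the corner of \<open>p\<close> that is almost annihilated by \<open>x\<close>,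
  gives \<open>g\<close>, \<open>\<psi>\<close> and \<open>v\<close> with \<open>v\<^sup>*v = 1 - g\<close> and \<open>v v\<^sup>*\<close> below \<open>t\<close>, hence below \<open>p\<close>.  On \<open>g + p (1 - g)\<close> the element
  \<open>\<psi> k + c (1 - g)\<close> is an invertible approximation of \<open>x\<close>.  The remaining part of \<open>x\<close> lives on
  \<open>P = (1 - p) (1 - g)\<close>, and \<open>w = v P\<close> moves \<open>P\<close> to an orthogonal projection, so that it can be
  completed to an invertible two-by-two block with off-diagonal entries \<open>w\<close> and \<open>w\<^sup>*\<close>.\<close>

section \<open>Square roots in C*-algebras\<close>

text \<open>\<open>w\<close> lies in the bicommutant of \<open>a\<close>. This supplies the
  commutation relations that a functional calculus would give for functions of
  \<open>a\<close>.\<close>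

definition bicomm :: "'a::cstar_algebra \<Rightarrow> 'a \<Rightarrow> bool"
  where "bicomm a w \<longleftrightarrow> (\<forall>c. c * a = a * c \<longrightarrow> c * w = w * c)"

lemma bicommD: "bicomm a w \<Longrightarrow> c * a = a * c \<Longrightarrow> c * w = w * c"
  by (simp add: bicomm_def)

section \<open>Closure properties of self-adjoint elements, norms of squares and projections\<close>

lemma star_one: "star 1 = (1 :: 'a::unital_cstar_algebra)"
  by (metis star_mult star_star mult_1_left mult_1_right)

lemma self_adjoint_one: "self_adjoint (1 :: 'a::unital_cstar_algebra)"
  by (simp add: self_adjoint_def star_one)

lemma self_adjoint_add: "self_adjoint x \<Longrightarrow> self_adjoint y \<Longrightarrow> self_adjoint (x + y)"
  by (simp add: self_adjoint_def star_add)

lemma self_adjoint_diff: "self_adjoint x \<Longrightarrow> self_adjoint y \<Longrightarrow> self_adjoint (x - y)"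
  by (simp add: self_adjoint_def star_diff)

lemma self_adjoint_scaleR: "self_adjoint x \<Longrightarrow> self_adjoint (r *\<^sub>R x)"
  by (simp add: self_adjoint_def star_scaleR)

lemma self_adjoint_mult:
  "self_adjoint x \<Longrightarrow> self_adjoint y \<Longrightarrow> x * y = y * x \<Longrightarrow> self_adjoint (x * y)"
  by (simp add: self_adjoint_def star_mult)

lemma self_adjoint_of_real: "self_adjoint (of_real r :: 'a::unital_cstar_algebra)"
  by (simp add: of_real_def self_adjoint_scaleR self_adjoint_one)

lemmas self_adjoint_intros = self_adjoint_one self_adjoint_add self_adjoint_diff
  self_adjoint_scaleR self_adjoint_of_real

lemma norm_self_adjoint_square: "self_adjoint x \<Longrightarrow> norm (x * x) = (norm x)\<^sup>2"
  using cstar_identity[of x] by (simp add: self_adjoint_def)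

lemma norm_projection_le: "projection p \<Longrightarrow> norm p \<le> 1"
  using norm_self_adjoint_square[of p]
  by (auto simp: projection_def power2_eq_square)

lemma scaleC_one: "scaleC 1 x = x" for x :: "'a::cstar_algebra"
  using scaleC_of_real[of 1 x] by simp

text \<open>For \<open>v = u + i w\<close> the C*-identity turns the right-hand side into the square
  of the norm of \<open>v\<close>, and \<open>u\<close> is the real part of \<open>v\<close>. This
  estimate takes the place of monotonicity of the norm on positive elements.\<close>

lemma norm_le_norm_add_squares:
  fixes u w :: "'a::cstar_algebra"
  assumes u: "self_adjoint u" and w: "self_adjoint w" and c: "u * w = w * u"
  shows "(norm u)\<^sup>2 \<le> norm (u * u + w * w)"
proof -
  define v where "v = u + scaleC \<i> w"
  have sv: "star v = u + scaleC (- \<i>) w"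
    using u w by (simp add: v_def star_add star_scaleC self_adjoint_def)
  have "star v * v = u * u + w * w + (scaleC \<i> (u * w) + scaleC (-\<i>) (u * w))"
    unfolding sv unfolding v_def
    by (simp add: algebra_simps mult_scaleC_left mult_scaleC_right scaleC_scaleC c scaleC_one
        scaleC_add_right)
  also have "scaleC \<i> (u * w) + scaleC (-\<i>) (u * w) = scaleC 0 (u * w)"
    by (subst scaleC_add_left[symmetric]) simp
  also have "\<dots> = 0" using scaleC_of_real[of 0 "u * w"] by simp
  finally have n: "(norm v)\<^sup>2 = norm (u * u + w * w)"
    using cstar_identity[of v] by simp
  have "scaleC \<i> w + scaleC (-\<i>) w = scaleC 0 w"
    by (subst scaleC_add_left[symmetric]) simp
  also have "\<dots> = 0" using scaleC_of_real[of 0 w] by simp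
  finally have "v + star v = 2 *\<^sub>R u"
    unfolding sv unfolding v_def by (simp add: algebra_simps scaleR_2)
  then have "2 * norm u = norm (v + star v)" by simp
  also have "\<dots> \<le> 2 * norm v" using norm_triangle_ineq[of v "star v"] by (simp add: norm_star)
  finally have "norm u \<le> norm v" by simp
  then have "(norm u)\<^sup>2 \<le> (norm v)\<^sup>2" by (rule power_mono) simp
  then show ?thesis using n by simp
qed

text \<open>The root is \<open>1 - y\<close> where \<open>y\<close> is the limit of the iteration \<open>y \<mapsto> (t + y\<^sup>2) / 2\<close>; the
  increments are majorized by those of the iteration with the real number \<open>\<parallel>t\<parallel>\<close> in place of \<open>t\<close>.\<close>

lemma sqrt_one_minus:
  fixes t :: "'a::unital_cstar_algebra"
  assumes t: "self_adjoint t" and t1: "norm t \<le> 1"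
  obtains y where "self_adjoint y" "norm y \<le> norm t" "(1 - y) * (1 - y) = 1 - t" "bicomm t y"
proof -
  define Y where "Y n = ((\<lambda>y. (t + y * y) /\<^sub>R 2) ^^ n) 0" for n
  define R where "R n = ((\<lambda>r. (norm t + r * r) / 2) ^^ n) 0" for n
  have Y: "Y 0 = 0" "Y (Suc n) = (t + Y n * Y n) /\<^sub>R 2" for n by (simp_all add: Y_def)
  have R: "R 0 = 0" "R (Suc n) = (norm t + R n * R n) / 2" for n by (simp_all add: R_def)
  have Rb: "0 \<le> R n \<and> R n \<le> norm t" for n
  proof (induction n)
    case (Suc n)
    have "R n * R n \<le> norm t * 1" using Suc t1 by (intro mult_mono) auto
    with Suc show ?case by (simp add: R)
  qed (simp add: R)
  have Rm: "R n \<le> R (Suc n)" for n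
  proof (induction n)
    case (Suc n)
    have "R n * R n \<le> R (Suc n) * R (Suc n)" using Suc Rb by (intro mult_mono) auto
    then show ?case by (simp add: R)
  qed (simp add: R)
  have comm: "c * Y n = Y n * c" if "c * t = t * c" for c n
  proof (induction n)
    case (Suc n)
    have "c * (Y n * Y n) = Y n * Y n * c" by (metis Suc mult.assoc)
    then show ?case by (simp add: Y algebra_simps that)
  qed (simp add: Y)
  have YY: "Y m * Y n = Y n * Y m" for m n
    by (rule comm) (rule comm[symmetric], simp)
  have sa: "self_adjoint (Y n)" for n
    by (induction n) (simp_all add: Y t self_adjoint_add self_adjoint_scaleR self_adjoint_mult,
        simp add: self_adjoint_def star_zero)
  have Yb: "norm (Y n) \<le> R n" for n
  proof (induction n)
    case (Suc n)
    have "norm (Y n * Y n) \<le> R n * R n"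
      using norm_mult_ineq[of "Y n" "Y n"] mult_mono[OF Suc Suc] Rb[of n] by fastforce
    then show ?case using norm_triangle_ineq[of t "Y n * Y n"] by (simp add: Y R)
  qed (simp add: Y R)
  have Yd: "norm (Y (Suc n) - Y n) \<le> R (Suc n) - R n" for n
  proof (induction n)
    case 0
    then show ?case by (simp add: Y R)
  next
    case (Suc n)
    \<comment> \<open>The difference of squares factors because the iterates commute. The real
      majorant has the same factorization, which carries the induction.\<close>
    have "(Y (Suc n) - Y n) * (Y (Suc n) + Y n) = Y (Suc n) * Y (Suc n) - Y n * Y n"
      using YY[of "Suc n" n] by (simp only: left_diff_distrib distrib_left) simp
    then have "Y (Suc (Suc n)) - Y (Suc n) = ((Y (Suc n) - Y n) * (Y (Suc n) + Y n)) /\<^sub>R 2"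
      by (simp add: Y(2)[of "Suc n"] Y(2)[of n, symmetric] scaleR_diff_right[symmetric])
        (simp add: Y(2) scaleR_diff_right[symmetric] algebra_simps)
    then have "norm (Y (Suc (Suc n)) - Y (Suc n))
        \<le> (norm (Y (Suc n) - Y n) * norm (Y (Suc n) + Y n)) / 2"
      using norm_mult_ineq[of "Y (Suc n) - Y n" "Y (Suc n) + Y n"] by simp
    also have "norm (Y (Suc n) - Y n) * norm (Y (Suc n) + Y n)
        \<le> (R (Suc n) - R n) * (R (Suc n) + R n)"
      using Suc Rm[of n] norm_triangle_le[of "Y (Suc n)" "Y n"] Yb[of n] Yb[of "Suc n"]
      by (intro mult_mono) auto
    also have "(R (Suc n) - R n) * (R (Suc n) + R n) / 2 = R (Suc (Suc n)) - R (Suc n)"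
      unfolding R(2)[of "Suc n"] by (subst (4) R(2)) (simp add: field_simps)
    finally show ?case by simp
  qed
  have "incseq R" using Rm by (rule incseq_SucI)
  then obtain L where L: "R \<longlonglongrightarrow> L" using Rb incseq_convergent[of R "norm t"] by blast
  from telescope_summable[OF L] have "summable (\<lambda>n. R (Suc n) - R n)" .
  then have "summable (\<lambda>n. norm (Y (Suc n) - Y n))"
    by (rule summable_comparison_test'[where N = 0]) (simp add: Yd)
  then have "summable (\<lambda>n. Y (Suc n) - Y n)" by (rule summable_norm_cancel)
  from summable_LIMSEQ[OF this] obtain y where "(\<lambda>n. \<Sum>k<n. Y (Suc k) - Y k) \<longlonglongrightarrow> y" by blast
  moreover have "(\<Sum>k<n. Y (Suc k) - Y k) = Y n" for n
    by (simp only: sum_lessThan_telescope Y(1) diff_0_right)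
  ultimately have lim: "Y \<longlonglongrightarrow> y" by simp
  have "(\<lambda>n. Y (Suc n)) \<longlonglongrightarrow> (t + y * y) /\<^sub>R 2"
    unfolding Y by (intro tendsto_intros lim)
  from LIMSEQ_unique[OF LIMSEQ_Suc[OF lim] this] have eq: "y = (t + y * y) /\<^sub>R 2" .
  \<comment> \<open>Completing the square in 2 y = t + y^2 gives (1 - y)^2 = 1 - t.\<close>
  have "2 *\<^sub>R y = t + y * y" by (subst eq) simp
  then have fp: "t = y + y - y * y" by (simp add: scaleR_2)
  show thesis
  proof (rule that)
    show "(1 - y) * (1 - y) = 1 - t" by (subst fp) (simp add: algebra_simps)
    show "bicomm t y" unfolding bicomm_def
    proof (intro allI impI)
      fix c assume "c * t = t * c"
      have "(\<lambda>n. c * Y n) \<longlonglongrightarrow> c * y" "(\<lambda>n. Y n * c) \<longlonglongrightarrow> y * c" by (intro tendsto_intros lim)+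
      with comm[OF \<open>c * t = t * c\<close>] show "c * y = y * c" by (simp add: LIMSEQ_unique)
    qed
    have "(\<lambda>n. star (Y n)) \<longlonglongrightarrow> star y" by (rule bounded_linear.tendsto[OF bounded_linear_star lim])
    with lim show "self_adjoint y" using sa by (simp add: self_adjoint_def LIMSEQ_unique)
    show "norm y \<le> norm t"
      by (rule LIMSEQ_le_const2[OF tendsto_norm[OF lim]]) (meson Yb Rb order_trans)
  qed
qed

text \<open>If \<open>m\<close> is a root of 2 - s^2 that commutes with \<open>s\<close>, then (1 -
  s^2)^2 + (s m)^2 = 1, and \<open>norm_le_norm_add_squares\<close> bounds the first summand. After
  scaling, this makes squares positive.\<close>

lemma norm_one_minus_square_le:
  fixes s :: "'a::unital_cstar_algebra"
  assumes s: "self_adjoint s" and s1: "norm s \<le> 1"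
  shows "norm (1 - s * s) \<le> 1"
proof -
  define t where "t = (s * s) /\<^sub>R 2"
  have ss: "norm (s * s) \<le> 1" using s1 by (simp add: norm_self_adjoint_square[OF s] power_le_one)
  have t: "self_adjoint t" "norm t \<le> 1"
    using ss by (simp_all add: t_def self_adjoint_scaleR self_adjoint_mult s)
  obtain y where y: "self_adjoint y" "(1 - y) * (1 - y) = 1 - t" "bicomm t y"
    using sqrt_one_minus[OF t] by metis
  define m where "m = sqrt 2 *\<^sub>R (1 - y)"
  have sy: "s * y = y * s" using y(3) by (rule bicommD) (simp add: t_def mult.assoc)
  have m1: "self_adjoint m" unfolding m_def by (intro self_adjoint_intros y(1))
  have m2: "s * m = m * s" by (simp add: m_def right_diff_distrib left_diff_distrib sy)
  have "m * m = 2 *\<^sub>R ((1 - y) * (1 - y))" by (simp add: m_def)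
  also have "\<dots> = 2 *\<^sub>R 1 - s * s" unfolding y(2) by (simp add: t_def scaleR_diff_right)
  finally have m3: "m * m = 2 - s * s" by (simp add: scaleR_2)
  have m4: "s * m * (s * m) = s * s * (2 - s * s)"
    by (metis m2 m3 mult.assoc)
  have m5: "s * s * (s * m) = s * m * (s * s)" by (metis m2 mult.assoc)
  have "(norm (1 - s * s))\<^sup>2 \<le> norm ((1 - s * s) * (1 - s * s) + s * m * (s * m))"
  proof (rule norm_le_norm_add_squares)
    show "self_adjoint (1 - s * s)" by (simp add: self_adjoint_intros self_adjoint_mult s)
    show "self_adjoint (s * m)" by (simp add: self_adjoint_mult s m1 m2)
    show "(1 - s * s) * (s * m) = s * m * (1 - s * s)"
      by (simp only: left_diff_distrib right_diff_distrib m5 mult_1_left mult_1_right)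
  qed
  also have "(1 - s * s) * (1 - s * s) + s * m * (s * m) = 1"
    unfolding m4 by (simp add: algebra_simps mult_2_right)
  finally show ?thesis by (simp add: power_le_one_iff abs_square_le_1)
qed

text \<open>Positivity without spectra: the inequality says that the spectrum of the self-adjoint \<open>a\<close> lies in
  \<open>[0, 2 r]\<close>.\<close>

definition psd :: "'a::unital_cstar_algebra \<Rightarrow> bool"
  where "psd a \<longleftrightarrow> self_adjoint a \<and> (\<exists>r. norm (of_real r - a) \<le> r)"

lemma psd_self_adjoint: "psd a \<Longrightarrow> self_adjoint a"
  by (simp add: psd_def)

lemma psdI: "self_adjoint a \<Longrightarrow> norm (of_real r - a) \<le> r \<Longrightarrow> psd a"
  by (auto simp: psd_def)

lemma psd_add:
  assumes "psd a" "psd b"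
  shows "psd (a + b)"
proof -
  obtain r s where "norm (of_real r - a) \<le> r" "norm (of_real s - b) \<le> s"
    using assms by (auto simp: psd_def)
  then have "norm (of_real (r + s) - (a + b)) \<le> r + s"
    using norm_triangle_ineq[of "of_real r - a" "of_real s - b"] by (simp add: algebra_simps)
  then show ?thesis
    by (intro psdI[of _ "r + s"]) (simp_all add: self_adjoint_add assms psd_self_adjoint)
qed

lemma psd_scaleR:
  assumes "psd a" "0 \<le> c"
  shows "psd (c *\<^sub>R a)"
proof -
  obtain r where r: "norm (of_real r - a) \<le> r" using assms by (auto simp: psd_def)
  have "of_real (c * r) - c *\<^sub>R a = c *\<^sub>R (of_real r - a)"
    by (simp add: scaleR_diff_right of_real_def)
  then have "norm (of_real (c * r) - c *\<^sub>R a) \<le> c * r"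
    using r assms(2) by (simp add: mult_left_mono)
  then show ?thesis
    by (intro psdI[of _ "c * r"]) (simp_all add: self_adjoint_scaleR assms psd_self_adjoint)
qed

lemma psd_square:
  assumes s: "self_adjoint s"
  shows "psd (s * s)"
proof -
  \<comment> \<open>The summand 1 keeps \<open>K\<close> positive when \<open>s = 0\<close>.\<close>
  define K where "K = norm s + 1"
  have K: "K > 0" by (simp add: K_def add_nonneg_pos)
  have "norm (1 - (s /\<^sub>R K) * (s /\<^sub>R K)) \<le> 1"
    using K by (intro norm_one_minus_square_le self_adjoint_scaleR s) (simp add: K_def divide_simps)
  moreover have "of_real (K * K) - s * s = (K * K) *\<^sub>R (1 - (s /\<^sub>R K) * (s /\<^sub>R K))"
    using K by (simp add: scaleR_diff_right of_real_def field_simps)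
  ultimately have "norm (of_real (K * K) - s * s) \<le> K * K"
    using K mult_left_le[of "norm (1 - (s /\<^sub>R K) * (s /\<^sub>R K))" "K * K"] by simp
  then show ?thesis by (intro psdI[of _ "K * K"]) (simp_all add: self_adjoint_mult s)
qed

text \<open>The bound on r - a says that a = r (1 - t) with \<open>t\<close> in the unit ball, so
  \<open>sqrt_one_minus\<close> gives the root sqrt r (1 - y). It lies within sqrt r of the scalar
  sqrt r and is therefore positive.\<close>

lemma psd_sqrt:
  assumes "psd a"
  obtains w where "psd w" "w * w = a" "bicomm a w"
proof -
  obtain r where a: "self_adjoint a" and r: "norm (of_real r - a) \<le> r"
    using assms by (auto simp: psd_def)
  show thesis
  proof (cases "r = 0")
    case True
    then have "a = 0" using r by simp
    then show thesis using assms by (intro that[of 0]) (simp_all add: bicomm_def)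
  next
    case False
    then have "r > 0" using r norm_ge_zero[of "of_real r - a"] by linarith
    define t where "t = (of_real r - a) /\<^sub>R r"
    have t: "self_adjoint t" "norm t \<le> 1"
      using r \<open>r > 0\<close> by (auto simp: t_def a intro!: self_adjoint_intros simp: divide_simps)
    obtain y where y: "self_adjoint y" "norm y \<le> norm t" "(1 - y) * (1 - y) = 1 - t" "bicomm t y"
      using sqrt_one_minus[OF t] by metis
    have at: "a = r *\<^sub>R (1 - t)"
      using \<open>r > 0\<close> by (simp add: t_def scaleR_diff_right of_real_def)
    show thesis
    proof (rule that[of "sqrt r *\<^sub>R (1 - y)"])
      have "of_real (sqrt r) - sqrt r *\<^sub>R (1 - y) = sqrt r *\<^sub>R y"
        by (simp add: scaleR_diff_right of_real_def)
      moreover have "norm y \<le> 1" using y(2) t(2) by linarith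
      ultimately have "norm (of_real (sqrt r) - sqrt r *\<^sub>R (1 - y)) \<le> sqrt r"
        using \<open>r > 0\<close> by (simp add: mult_left_le)
      then show "psd (sqrt r *\<^sub>R (1 - y))"
        by (auto simp: psd_def intro!: self_adjoint_intros y(1))
      show "sqrt r *\<^sub>R (1 - y) * (sqrt r *\<^sub>R (1 - y)) = a"
        using \<open>r > 0\<close> by (simp add: y(3) at)
      show "bicomm a (sqrt r *\<^sub>R (1 - y))"
        unfolding bicomm_def
      proof (intro allI impI)
        fix c assume "c * a = a * c"
        then have "c * t = t * c"
          by (simp add: t_def right_diff_distrib left_diff_distrib of_real_def)
        then have "c * y = y * c" by (rule bicommD[OF y(4)])
        then show "c * (sqrt r *\<^sub>R (1 - y)) = sqrt r *\<^sub>R (1 - y) * c"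
          by (simp add: right_diff_distrib left_diff_distrib)
      qed
    qed
  qed
qed

text \<open>Two uses of the bicommutant show that the roots \<open>u\<close> and \<open>v\<close>
  commute, so a b is the square of the self-adjoint element u v.\<close>

lemma psd_mult:
  assumes "psd a" "psd b" and ab: "a * b = b * a"
  shows "psd (a * b)"
proof -
  obtain u where u: "psd u" "u * u = a" "bicomm a u" using psd_sqrt[OF assms(1)] by metis
  obtain v where v: "psd v" "v * v = b" "bicomm b v" using psd_sqrt[OF assms(2)] by metis
  have "b * u = u * b" by (rule bicommD[OF u(3)]) (simp add: ab)
  then have uv: "u * v = v * u" by (intro bicommD[OF v(3)]) simp
  then have "a * b = (u * v) * (u * v)" using u(2) v(2) by (metis mult.assoc)
  then show ?thesis using psd_square[of "u * v"] u v uv by (simp add: psd_self_adjoint self_adjoint_mult)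
qed

text \<open>This is \<open>norm_le_norm_add_squares\<close> for the commuting roots of
  \<open>a\<close> and \<open>b\<close>.\<close>

lemma psd_norm_le_add:
  assumes "psd a" "psd b" and ab: "a * b = b * a"
  shows "norm a \<le> norm (a + b)"
proof -
  obtain u where u: "psd u" "u * u = a" "bicomm a u" using psd_sqrt[OF assms(1)] by metis
  obtain v where v: "psd v" "v * v = b" "bicomm b v" using psd_sqrt[OF assms(2)] by metis
  have "b * u = u * b" by (rule bicommD[OF u(3)]) (simp add: ab)
  then have uv: "u * v = v * u" by (intro bicommD[OF v(3)]) simp
  from norm_le_norm_add_squares[OF psd_self_adjoint[OF u(1)] psd_self_adjoint[OF v(1)] uv]
  show ?thesis using norm_self_adjoint_square[OF psd_self_adjoint[OF u(1)]] u(2) v(2) by simp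
qed

section \<open>Inverses, polar decomposition and contractivity of homomorphisms\<close>

lemma inverse_near_one:
  fixes x :: "'a::unital_cstar_algebra"
  assumes "norm (1 - x) < 1"
  obtains y where "x * y = 1" "y * x = 1"
proof -
  define t where "t = 1 - x"
  have "summable (\<lambda>n. norm t ^ n)" using assms by (simp add: t_def summable_geometric)
  then have "summable (\<lambda>n. norm (t ^ n))"
    by (rule summable_comparison_test'[where N = 0]) (simp add: norm_power_ineq)
  then have s: "summable (\<lambda>n. t ^ n)" by (rule summable_norm_cancel)
  have e: "(\<Sum>n. t ^ Suc n) = (\<Sum>n. t ^ n) - 1" using suminf_split_head[OF s] by simp
  have l: "t * (\<Sum>n. t ^ n) = (\<Sum>n. t ^ n) - 1"
    unfolding e[symmetric] by (simp add: suminf_mult[OF s])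
  have r: "(\<Sum>n. t ^ n) * t = (\<Sum>n. t ^ n) - 1"
    unfolding e[symmetric] by (simp add: suminf_mult2[OF s] power_commutes)
  have x: "x = 1 - t" by (simp add: t_def)
  show thesis
    by (rule that[of "\<Sum>n. t ^ n"]) (simp_all add: x left_diff_distrib right_diff_distrib l r)
qed

lemma inverse_commute:
  fixes x :: "'a::ring_1"
  assumes "x * y = 1" "y * x = 1" "c * x = x * c"
  shows "c * y = y * c"
  by (metis assms mult.assoc mult_1_left mult_1_right)

lemma inverse_self_adjoint:
  fixes x :: "'a::unital_cstar_algebra"
  assumes "x * y = 1" "y * x = 1" "self_adjoint x"
  shows "self_adjoint y"
  using assms by (metis self_adjoint_def star_mult star_one mult.assoc mult_1_left mult_1_right)

text \<open>Scaled by 1 / (r + 1), the element 1 + a comes within r / (r + 1) < 1 of the unit, so it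
  is invertible. For the norm of the inverse \<open>d\<close>, write (1 + a)^2 = 1 + e with e = 2 a
  + a^2 positive: then d^2 + e d^2 = 1, and \<open>psd_norm_le_add\<close> bounds d^2.\<close>

lemma psd_one_plus_inverse:
  assumes a: "psd a"
  obtains d where "self_adjoint d" "(1 + a) * d = 1" "d * (1 + a) = 1" "norm d \<le> 1"
    "\<And>c. c * a = a * c \<Longrightarrow> c * d = d * c"
proof -
  obtain r where sa: "self_adjoint a" and r: "norm (of_real r - a) \<le> r"
    using assms by (auto simp: psd_def)
  have "r \<ge> 0" using r norm_ge_zero order_trans by blast
  define x where "x = (1 + a) /\<^sub>R (r + 1)"
  have "1 - x = (of_real r - a) /\<^sub>R (r + 1)"
    using \<open>r \<ge> 0\<close> by (simp add: x_def of_real_def scaleR_diff_right scaleR_add_right algebra_simps)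
      (simp add: scaleR_add_left[symmetric] divide_simps)
  then have "norm (1 - x) < 1" using r \<open>r \<ge> 0\<close> by (simp add: divide_simps)
  then obtain y where y: "x * y = 1" "y * x = 1" by (rule inverse_near_one)
  define d where "d = y /\<^sub>R (r + 1)"
  have d: "(1 + a) * d = 1" "d * (1 + a) = 1" using y by (simp_all add: d_def x_def)
  have cd: "c * d = d * c" if "c * a = a * c" for c
    by (rule inverse_commute[OF d]) (simp add: that algebra_simps)
  have sd: "self_adjoint d"
    by (rule inverse_self_adjoint[OF d]) (intro self_adjoint_intros sa)
  have ad: "a * d = d * a" by (rule cd) simp
  define e where "e = a + a + a * a"
  have e: "psd e" unfolding e_def by (intro psd_add psd_square sa a)
  have "a * (d * d) = (d * d) * a" by (metis ad mult.assoc)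
  then have ed: "e * (d * d) = (d * d) * e"
    unfolding e_def distrib_left distrib_right by (metis mult.assoc)
  have "d * d + e * (d * d) = ((1 + a) * (1 + a)) * (d * d)" by (simp add: e_def algebra_simps)
  also have "\<dots> = 1" by (metis d mult.assoc mult_1_left)
  finally have "d * d + e * (d * d) = 1" .
  moreover have "norm (d * d) \<le> norm (d * d + e * (d * d))"
  proof (rule psd_norm_le_add)
    show "psd (d * d)" by (rule psd_square[OF sd])
    show "psd (e * (d * d))" by (rule psd_mult[OF e \<open>psd (d * d)\<close> ed])
    show "d * d * (e * (d * d)) = e * (d * d) * (d * d)" by (metis ed mult.assoc)
  qed
  ultimately have "norm d \<le> 1"
    by (simp add: norm_self_adjoint_square[OF sd] abs_square_le_1)
  then show thesis by (intro that[OF sd d _ cd])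
qed

text \<open>Polar decomposition: \<open>m\<close> is the modulus of \<open>k\<close> and
  \<open>u\<close> its sign. The modulus \<open>a\<close> has the inverse a l^2, because a^2 =
  k^2.\<close>

lemma sign_decomposition:
  fixes k :: "'a::unital_cstar_algebra"
  assumes k: "self_adjoint k" and l: "k * l = 1" "l * k = 1"
  obtains u m where "self_adjoint u" "u * u = 1" "psd m" "u * k = m" "k * u = m"
proof -
  obtain a where a: "psd a" "a * a = k * k" "bicomm (k * k) a"
    using psd_sqrt[OF psd_square[OF k]] by metis
  have ka: "k * a = a * k" using a(3) by (rule bicommD) (simp add: mult.assoc)
  have la: "l * a = a * l" using a(3) by (rule bicommD) (metis l mult.assoc mult_1_left mult_1_right)
  define d where "d = a * (l * l)"
  have ad: "a * d = 1" unfolding d_def by (metis a(2) l mult.assoc mult_1_left)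
  have da: "d * a = 1" unfolding d_def by (metis a(2) la l mult.assoc mult_1_left)
  have kd: "k * d = d * k" by (rule inverse_commute[OF ad da ka])
  have sd: "self_adjoint d" by (rule inverse_self_adjoint[OF ad da psd_self_adjoint[OF a(1)]])
  have dkk: "d * (k * k) = a" by (metis a(2) da mult.assoc mult_1_left)
  show thesis
  proof (rule that[of "k * d" a])
    show "self_adjoint (k * d)" by (simp add: self_adjoint_mult k sd kd)
    show "k * d * (k * d) = 1" by (metis kd dkk ad mult.assoc)
    show "psd a" by (rule a)
    show "k * d * k = a" by (metis kd dkk mult.assoc)
    show "k * (k * d) = a" by (metis kd dkk mult.assoc)
  qed
qed

text \<open>For a self-adjoint contraction \<open>s\<close>, let 1 - y be a root of 1 - s^2. Then
  f(s)^2 + f(1 - y)^2 = f(1), a projection even if \<open>f\<close> is not unital, so f(s) is a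
  contraction. The C*-identity extends the bound to all elements.\<close>

lemma star_hom_contractive:
  fixes f :: "'b::unital_cstar_algebra \<Rightarrow> 'c::cstar_algebra"
  assumes "star_hom f"
  shows "norm (f b) \<le> norm b"
proof -
  have add: "f (x + y) = f x + f y" and sc: "f (scaleC c x) = scaleC c (f x)"
    and mult: "f (x * y) = f x * f y" and st: "f (star x) = star (f x)" for x y c
    using assms by (auto simp: star_hom_def)
  have scR: "f (r *\<^sub>R x) = r *\<^sub>R f x" for r x
    using sc[of "complex_of_real r"] by (simp add: scaleC_of_real)
  have p: "projection (f 1)"
    by (simp add: projection_def self_adjoint_def st[symmetric] mult[symmetric] star_one)
  have 1: "norm (f s) \<le> 1" if s: "self_adjoint s" "norm s \<le> 1" for s
  proof -
    have ss: "self_adjoint (s * s)" "norm (s * s) \<le> 1"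
      using s(2) by (simp_all add: self_adjoint_mult s(1) norm_self_adjoint_square power_le_one)
    obtain y where y: "self_adjoint y" "(1 - y) * (1 - y) = 1 - s * s" "bicomm (s * s) y"
      using sqrt_one_minus[OF ss] by metis
    have "s * y = y * s" using y(3) by (rule bicommD) (simp add: mult.assoc)
    then have c: "s * (1 - y) = (1 - y) * s" by (simp add: algebra_simps)
    have sa: "self_adjoint (f s)" "self_adjoint (f (1 - y))"
      using s(1) self_adjoint_diff[OF self_adjoint_one y(1)] by (simp_all add: self_adjoint_def st[symmetric])
    have "s * s + (1 - y) * (1 - y) = 1" by (simp add: y(2))
    then have "f s * f s + f (1 - y) * f (1 - y) = f 1" by (metis add mult)
    moreover have "f s * f (1 - y) = f (1 - y) * f s" by (metis c mult)
    ultimately have "(norm (f s))\<^sup>2 \<le> norm (f 1)" using norm_le_norm_add_squares[OF sa] by simp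
    then have "(norm (f s))\<^sup>2 \<le> 1" using norm_projection_le[OF p] by linarith
    then show ?thesis by (simp add: abs_square_le_1)
  qed
  have 2: "norm (f s) \<le> norm s" if s: "self_adjoint s" for s
  proof (cases "s = 0")
    case True
    then show ?thesis using scR[of 0 0] by simp
  next
    case False
    then show ?thesis
      using 1[of "s /\<^sub>R norm s"] s by (simp add: self_adjoint_scaleR scR divide_simps split: if_splits)
  qed
  have "self_adjoint (star b * b)" by (simp add: self_adjoint_def star_mult star_star)
  from 2[OF this] have "(norm (f b))\<^sup>2 \<le> (norm b)\<^sup>2" by (simp add: mult st cstar_identity)
  then show ?thesis by (rule power2_le_imp_le) simp
qed

section \<open>Perturbations\<close>

text \<open>In functional calculus terms \<open>z = 2 max (1 - \<bar>x\<bar>) 0\<close> and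
  \<open>x - x' = x / (\<bar>x\<bar> + \<bar>1 - \<bar>x\<bar>\<bar>)\<close>.\<close>

lemma annihilated_perturbation:
  fixes x :: "'a::unital_cstar_algebra"
  assumes x: "self_adjoint x" and ni: "\<not> invertible_element x"
  obtains x' z where "self_adjoint x'" "norm (x - x') \<le> 1" "self_adjoint z" "z \<noteq> 0" "x' * z = 0"
proof -
  obtain a where a: "psd a" "a * a = x * x" "bicomm (x * x) a"
    using psd_sqrt[OF psd_square[OF x]] by metis
  note sa = psd_self_adjoint[OF a(1)]
  have xa: "x * a = a * x" using a(3) by (rule bicommD) (simp add: mult.assoc)
  have s1: "self_adjoint (1 - a)" by (intro self_adjoint_intros sa)
  obtain b where b: "psd b" "b * b = (1 - a) * (1 - a)" "bicomm ((1 - a) * (1 - a)) b"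
    using psd_sqrt[OF psd_square[OF s1]] by metis
  note sb = psd_self_adjoint[OF b(1)]
  have xs: "x * (1 - a) = (1 - a) * x" by (simp add: algebra_simps xa)
  have xb: "x * b = b * x" using b(3) by (rule bicommD) (metis xs mult.assoc)
  have ab: "a * b = b * a" using b(3) by (rule bicommD) (simp add: algebra_simps)
  \<comment> \<open>\<open>h\<close> is |x| + |1 - |x||. The identity 2 h^2 = 1 + e with
    \<open>e\<close> positive makes it invertible.\<close>
  define h where "h = a + b"
  define e where "e = (1 - 2 *\<^sub>R a) * (1 - 2 *\<^sub>R a) + 4 *\<^sub>R (a * b)"
  have pab: "psd (a * b)" by (rule psd_mult[OF a(1) b(1) ab])
  have e: "psd e"
    unfolding e_def by (intro psd_add psd_square psd_scaleR pab self_adjoint_intros sa) simp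
  have hh: "h * h = a * a + 2 *\<^sub>R (a * b) + (1 - a) * (1 - a)"
    unfolding h_def distrib_left distrib_right b(2)[symmetric] ab by (simp add: scaleR_2)
  have he: "2 *\<^sub>R (h * h) = 1 + e"
    unfolding hh e_def by (simp add: algebra_simps scaleR_2[symmetric] scaleR_add_right)
  obtain D where D: "self_adjoint D" "(1 + e) * D = 1" "D * (1 + e) = 1"
      "\<And>c. c * e = e * c \<Longrightarrow> c * D = D * c"
    using psd_one_plus_inverse[OF e] by metis
  have De: "c * D = D * c" if "c * h = h * c" for c
  proof (rule D(4))
    have "c * (1 + e) = (1 + e) * c" unfolding he[symmetric] using that
      by simp (metis mult.assoc)
    then show "c * e = e * c" by (simp add: algebra_simps)
  qed
  define d where "d = 2 *\<^sub>R (h * D)"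
  have hD: "h * D = D * h" by (rule De) simp
  have hd: "h * d = 1" using D(2) by (simp add: d_def he[symmetric] mult.assoc)
  have dh: "d * h = 1" using D(3) by (simp add: d_def he[symmetric] hD mult.assoc)
  have sh: "self_adjoint h" unfolding h_def by (intro self_adjoint_intros sa sb)
  have sd: "self_adjoint d" by (rule inverse_self_adjoint[OF hd dh sh])
  have ch: "c * d = d * c" if "c * a = a * c" "c * b = b * c" for c
    by (rule inverse_commute[OF hd dh]) (simp add: h_def algebra_simps that)
  have xd: "x * d = d * x" by (rule ch[OF xa xb])
  have ad: "a * d = d * a" by (rule ch) (simp_all add: ab)
  have bd: "b * d = d * b" by (rule ch) (simp_all add: ab)
  \<comment> \<open>\<open>f\<close> is h^2 - a^2. Hence a^2 d^2, which equals (x d)^2, and f d^2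
    are commuting positive elements with sum 1, and x d is a contraction.\<close>
  define f where "f = 2 *\<^sub>R (a * b) + b * b"
  have f: "psd f" unfolding f_def by (intro psd_add psd_scaleR pab psd_square sb) simp
  have fdd: "f * (d * d) = d * d * f"
    unfolding f_def by (simp add: algebra_simps) (metis ad bd mult.assoc)
  have add: "a * a * (d * d) = d * d * (a * a)" by (metis ad mult.assoc)
  have af: "a * a * f = f * (a * a)"
    unfolding f_def by (simp add: algebra_simps) (metis ab mult.assoc)
  have pdd: "psd (d * d)" by (rule psd_square[OF sd])
  have "norm (a * a * (d * d)) \<le> norm (a * a * (d * d) + f * (d * d))"
  proof (rule psd_norm_le_add)
    show "psd (a * a * (d * d))" by (rule psd_mult[OF psd_square[OF sa] pdd add])
    show "psd (f * (d * d))" by (rule psd_mult[OF f pdd fdd])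
    have *: "A * E * (f * E) = f * E * (A * E)" if "A * E = E * A" "A * f = f * A" "f * E = E * f"
      for A E by (metis that mult.assoc)
    show "a * a * (d * d) * (f * (d * d)) = f * (d * d) * (a * a * (d * d))"
      by (rule *[OF add af fdd])
  qed
  also have "a * a * (d * d) + f * (d * d) = h * h * (d * d)"
    unfolding hh f_def b(2) by (simp add: algebra_simps)
  also have "\<dots> = 1" by (metis hd mult.assoc mult_1_right)
  also have "a * a * (d * d) = x * d * (x * d)" by (metis a(2) xd mult.assoc)
  finally have nxd: "norm (x * d) \<le> 1"
    by (simp add: norm_self_adjoint_square[OF self_adjoint_mult[OF x sd xd]] abs_square_le_1)
  \<comment> \<open>Because b^2 = (1 - a)^2, multiplication by \<open>h\<close> fixes
    \<open>z\<close>. So does its inverse \<open>d\<close>, and x - x d annihilates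
    \<open>z\<close>.\<close>
  define z where "z = 1 - a + b"
  have "h * z = z + (b * b - (1 - a) * (1 - a))"
    by (simp add: h_def z_def algebra_simps ab)
  then have hz: "h * z = z" by (simp add: b(2))
  have dz: "d * z = z" by (metis hz dh mult.assoc mult_1_left)
  show thesis
  proof (rule that[of "x - x * d" z])
    show "self_adjoint (x - x * d)" by (intro self_adjoint_diff self_adjoint_mult x sd xd)
    show "norm (x - (x - x * d)) \<le> 1" using nxd by simp
    show "self_adjoint z" unfolding z_def by (intro self_adjoint_intros sa sb)
    show "(x - x * d) * z = 0" by (simp add: left_diff_distrib mult.assoc dz)
    show "z \<noteq> 0"
    proof
      \<comment> \<open>Then |x| would be 1 + b with \<open>b\<close> positive, hence invertible,
        and \<open>x\<close> with it.\<close>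
      assume "z = 0"
      then have ba: "a = 1 + b" by (simp add: z_def algebra_simps)
      obtain c where c: "a * c = 1" "c * a = 1"
        using psd_one_plus_inverse[OF b(1)] unfolding ba[symmetric] by metis
      have xc: "x * c = c * x" by (rule inverse_commute[OF c xa])
      have "x * (x * (c * c)) = 1" by (metis a(2) c mult.assoc mult_1_left)
      moreover have "x * (c * c) * x = 1" by (metis a(2) c xc mult.assoc mult_1_left)
      ultimately have "invertible_element x" unfolding invertible_element_def by blast
      with ni show False ..
    qed
  qed
qed

text \<open>With \<open>k0\<close> invertible near \<open>s + 1\<close>, the choice \<open>k = k0 + sgn k0\<close> opens a spectral gap of size 1
  and sends the spectral value 1 of \<open>k0\<close> to 2.\<close>

lemma invertible_perturbation:
  fixes s :: "'b::unital_cstar_algebra"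
  assumes rr: "real_rank_zero TYPE('b)" and s: "self_adjoint s" and eta: "0 < \<eta>" "\<eta> \<le> 1"
  obtains k j N where "self_adjoint k" "k * j = 1" "j * k = 1" "norm j \<le> 1" "norm (k - s) \<le> 3"
    "norm N \<le> 3" "norm (k - 2 - N * s) \<le> \<eta>"
proof -
  have "self_adjoint (s + 1)" by (intro self_adjoint_intros s)
  then have "s + 1 \<in> closure {x. self_adjoint x \<and> invertible_element x}"
    using rr by (auto simp: real_rank_zero_def)
  \<comment> \<open>The tolerance is divided by 3 because the error is multiplied by
    \<open>N\<close> in the last estimate.\<close>
  then obtain k0 where k0: "self_adjoint k0" "invertible_element k0" "dist k0 (s + 1) < \<eta> / 3"
    using eta closure_approachable[of "s + 1"] by (auto dest!: spec[of _ "\<eta> / 3"])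
  obtain l where l: "k0 * l = 1" "l * k0 = 1" using k0(2) by (auto simp: invertible_element_def)
  obtain u m where u: "self_adjoint u" "u * u = 1" "psd m" "u * k0 = m" "k0 * u = m"
    using sign_decomposition[OF k0(1) l] by metis
  obtain D where D: "(1 + m) * D = 1" "D * (1 + m) = 1" "norm D \<le> 1"
      "\<And>c. c * m = m * c \<Longrightarrow> c * D = D * c"
    using psd_one_plus_inverse[OF u(3)] by metis
  have um: "u * m = k0" by (metis u(2,4) mult.assoc mult_1_left)
  have mu: "m * u = k0" by (metis u(2,5) mult.assoc mult_1_right)
  have km: "k0 * m = m * k0" by (metis u(4,5) mult.assoc)
  have kD: "k0 * D = D * k0" by (rule D(4)[OF km])
  have "(norm u)\<^sup>2 = 1" using norm_self_adjoint_square[OF u(1)] u(2) by simp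
  then have nu: "norm u = 1" by (simp add: power2_eq_1_iff) (smt (verit) norm_ge_zero)
  define k where "k = k0 + u"
  \<comment> \<open>Since (1 - u)(1 + m) = (u - 1)(k0 - 1), the element u - 1 equals (1 - u) D (k0 -
    1). So k - 2 = (k0 - 1) + (u - 1) is \<open>N\<close> times k0 - 1, which is close to
    \<open>s\<close>.\<close>
  define N where "N = 1 + (1 - u) * D"
  have k: "k = (1 + m) * u" "k = u * (1 + m)" by (simp_all add: k_def algebra_simps um mu)
  have "(1 - u) * (1 + m) = (u - 1) * (k0 - 1)"
    by (simp add: algebra_simps um u(4))
  then have "(1 - u) * ((1 + m) * D) = (u - 1) * ((k0 - 1) * D)" by (metis mult.assoc)
  moreover have "(k0 - 1) * D = D * (k0 - 1)" by (simp add: algebra_simps kD)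
  ultimately have "1 - u = (u - 1) * (D * (k0 - 1))" by (simp only: D(1) mult_1_right)
  then have u1: "u - 1 = (1 - u) * (D * (k0 - 1))" by (metis minus_diff_eq minus_mult_left)
  have kN: "k - 2 = N * (k0 - 1)"
    unfolding N_def distrib_right mult.assoc u1[symmetric] by (simp add: k_def)
  have k0s: "norm (k0 - (s + 1)) < \<eta> / 3" using k0(3) by (simp add: dist_norm)
  have "norm (1 - u) \<le> 2" using norm_triangle_ineq4[of 1 u] nu by simp
  then have "norm (1 - u) * norm D \<le> 2 * 1" using D(3) by (intro mult_mono) auto
  then have "norm ((1 - u) * D) \<le> 2" using norm_mult_ineq[of "1 - u" D] by linarith
  then have N: "norm N \<le> 3" unfolding N_def using norm_triangle_ineq[of 1 "(1 - u) * D"] by simp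
  show thesis
  proof (rule that[of k "D * u" N])
    show "self_adjoint k" unfolding k_def by (intro self_adjoint_intros k0 u)
    show "k * (D * u) = 1" by (metis k(2) D(1) u(2) mult.assoc mult_1_left)
    show "D * u * k = 1" by (metis k(2) D(2) u(2) mult.assoc mult_1_left)
    show "norm (D * u) \<le> 1" using norm_mult_ineq[of D u] D(3) nu by simp
    have "k - s = (k0 - (s + 1)) + (1 + u)" by (simp add: k_def)
    then have "norm (k - s) \<le> norm (k0 - (s + 1)) + norm (1 + u)"
      by (metis norm_triangle_ineq)
    then show "norm (k - s) \<le> 3"
      using norm_triangle_ineq[of 1 u] nu k0s eta by simp
    show "norm N \<le> 3" by (rule N)
    have "k - 2 - N * s = N * (k0 - (s + 1))" unfolding kN by (simp add: algebra_simps)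
    then have "norm (k - 2 - N * s) \<le> norm N * norm (k0 - (s + 1))" by (simp add: norm_mult_ineq)
    also have "\<dots> \<le> 3 * (\<eta> / 3)" using N k0s by (intro mult_mono) auto
    finally show "norm (k - 2 - N * s) \<le> \<eta>" by simp
  qed
qed

section \<open>Cutting by projections and the two-by-two block\<close>

lemma norm_mult_projections_le:
  fixes F G :: "'a::cstar_algebra"
  assumes "projection F" "projection G"
  shows "norm (F * y * G) \<le> norm y"
proof -
  have "norm (F * y) \<le> 1 * norm y"
    by (rule order_trans[OF norm_mult_ineq]) (intro mult_right_mono norm_projection_le assms norm_ge_zero)
  moreover have "norm (F * y * G) \<le> norm (F * y) * 1"
    by (rule order_trans[OF norm_mult_ineq]) (intro mult_left_mono norm_projection_le assms norm_ge_zero)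
  ultimately show ?thesis by simp
qed

lemma projection_one_minus:
  "projection p \<Longrightarrow> projection (1 - p)" for p :: "'a::unital_cstar_algebra"
  by (auto simp: projection_def self_adjoint_intros algebra_simps)

text \<open>By the C*-identity, as the product of the adjoint of w - w P with w - w P is P - P - P +
  P = 0.\<close>

lemma partial_isometry_source:
  assumes "projection P" "star w * w = P"
  shows "w * P = w"
proof -
  have "star (w - w * P) * (w - w * P) = 0"
    using assms
    by (simp add: star_diff star_mult projection_def self_adjoint_def algebra_simps)
      (metis mult.assoc diff_self)
  then have "(norm (w - w * P))\<^sup>2 = 0" using cstar_identity[of "w - w * P"] by simp
  then show ?thesis by simp
qed

text \<open>Let \<open>q\<close> be the range projection of \<open>w\<close>, orthogonal to
  \<open>P\<close>, and \<open>F\<close> the complement of P + q. On P + q the element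
  \<open>T\<close> is the block with diagonal entries P x P, 0 and off-diagonal entries
  \<open>w\<close> and its adjoint. Its inverse has off-diagonal entries of the same form and
  diagonal entries 0, - w x (star w), whatever the size of P x P. On \<open>F\<close> the
  compression of \<open>K\<close> is almost inverted by that of \<open>J\<close>, since
  \<open>K\<close> is almost 2 on \<open>q\<close> and hardly mixes \<open>q\<close> with
  \<open>F\<close>.\<close>

lemma corner_perturbation:
  fixes x :: "'a::unital_cstar_algebra"
  assumes x: "self_adjoint x" and K: "self_adjoint K"
    and P: "projection P" and ww: "star w * w = P" and Pw: "P * w = 0"
    and PK: "P * K = 0" and KJ: "norm (K * J - (1 - P)) \<le> 1 / 100"
    and Kq: "norm ((K - 2) * (w * star w)) \<le> 1 / 10" and J: "norm J \<le> 3"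
    and xK: "norm (x * (1 - P) - K) \<le> 7" and xP: "norm (x * P - P * x) \<le> 1 / 100"
  obtains T S where "self_adjoint T" "norm (x - T) \<le> 20" "norm (T * S - 1) < 1"
proof -
  define w' where "w' = star w"
  have sP: "star P = P" and PP: "P * P = P" using P by (auto simp: projection_def self_adjoint_def)
  have KP: "K * P = 0"
    using arg_cong[OF PK, of star] K by (simp add: star_mult sP star_zero self_adjoint_def)
  have wP: "w * P = w" by (rule partial_isometry_source[OF P ww])
  have w'w: "w' * w = P" by (simp add: w'_def ww)
  have Pw': "P * w' = w'" using arg_cong[OF wP, of star] by (simp add: star_mult sP w'_def)
  have w'P: "w' * P = 0" using arg_cong[OF Pw, of star] by (simp add: star_mult sP w'_def star_zero)
  have w2: "w * w = 0" by (metis Pw wP mult.assoc mult_zero_right)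
  have w'2: "w' * w' = 0" by (metis w'P Pw' mult.assoc mult_zero_left)
  define q where "q = w * w'"
  define F where "F = 1 - P - q"
  have sq: "star q = q" by (simp add: q_def w'_def star_mult star_star)
  have sF: "star F = F" by (simp add: F_def star_diff star_one sP sq)
  have qq: "q * q = q" unfolding q_def by (metis w'w wP mult.assoc)
  have Pq: "P * q = 0" unfolding q_def by (metis Pw mult.assoc mult_zero_left)
  have qP: "q * P = 0" unfolding q_def by (metis w'P mult.assoc mult_zero_right)
  have qw: "q * w = w" unfolding q_def by (metis w'w wP mult.assoc)
  have w'q: "w' * q = w'" unfolding q_def by (metis w'w Pw' mult.assoc)
  have qw': "q * w' = 0" unfolding q_def by (metis w'2 mult.assoc mult_zero_right)
  have wq: "w * q = 0" unfolding q_def by (metis w2 mult.assoc mult_zero_left)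
  have F: "F * F = F" "F * P = 0" "P * F = 0" "F * w = 0" "w * F = 0" "F * w' = 0" "w' * F = 0"
      "F * q = 0"
    by (simp_all add: F_def algebra_simps PP Pq qP qq Pw qw wP wq Pw' qw' w'P w'q)
  have pq: "projection q" and pF: "projection F"
    using sq qq sF F(1) by (auto simp: projection_def self_adjoint_def)
  note rules = F PP Pw wP Pw' w'P w2 w'2 w'w
  \<comment> \<open>The same product rules with a further factor on the right, for rewriting
    right-associated words.\<close>
  note rules' = rules[THEN arg_cong[where f = "\<lambda>a. a * b" for b], unfolded mult.assoc]
  define T where "T = P * x * P + w + w' + F * K * F"
  define S where "S = F * J * F + w + w' - w * x * w'"
  have TS: "T * S = F * K * F * J * F + P + q"
    unfolding T_def S_def q_def
    by (simp add: distrib_left distrib_right left_diff_distrib right_diff_distrib mult.assoc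
        rules rules')
  \<comment> \<open>Replace the middle \<open>F\<close> by 1 - P - q. The \<open>P\<close> term dies
    because K P = 0, and in the \<open>q\<close> term \<open>K\<close> may be exchanged for K - 2
    because F q = 0.\<close>
  have "F * K * F * J * F - F = F * (K * J - (1 - P)) * F - F * ((K - 2) * q * J) * F"
  proof -
    have "F * K * F * J * F = F * K * (1 - P - q) * J * F" by (simp only: F_def[symmetric])
    also have "\<dots> = F * (K * J) * F - F * (K * P) * (J * F) - F * K * q * J * F"
      by (simp add: algebra_simps)
    also have "F * K * q = F * (K - 2) * q + 2 * (F * q)" by (simp add: algebra_simps mult_2 mult_2_right)
    finally have "F * K * F * J * F = F * (K * J) * F - F * (K - 2) * q * J * F" by (simp add: KP F)
    moreover have "F * (K * J - (1 - P)) * F = F * (K * J) * F - F"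
      by (simp add: algebra_simps F)
    ultimately show ?thesis by (simp add: mult.assoc)
  qed
  moreover have "a + P + q - 1 = a - F" for a by (simp add: F_def)
  ultimately have "T * S - 1 = F * (K * J - (1 - P)) * F - F * ((K - 2) * q * J) * F"
    by (simp only: TS)
  then have "norm (T * S - 1)
      \<le> norm (F * (K * J - (1 - P)) * F) + norm (F * ((K - 2) * q * J) * F)"
    by (simp only: norm_triangle_ineq4)
  also have "\<dots> \<le> norm (K * J - (1 - P)) + norm ((K - 2) * q * J)"
    by (intro add_mono norm_mult_projections_le pF)
  finally have "norm (T * S - 1) \<le> norm (K * J - (1 - P)) + norm ((K - 2) * q * J)" .
  moreover have "norm ((K - 2) * q * J) \<le> 1 / 10 * 3"
    using Kq J unfolding q_def w'_def
    by (intro order_trans[OF norm_mult_ineq[of "(K - 2) * (w * star w)"]] mult_mono) auto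
  ultimately have TS1: "norm (T * S - 1) < 1" using KJ by linarith
  have nw: "norm w \<le> 1"
  proof -
    have "(norm w)\<^sup>2 \<le> 1" using cstar_identity[of w] ww norm_projection_le[OF P] by simp
    then show ?thesis by (simp add: abs_square_le_1)
  qed
  have nq: "norm q \<le> 1" by (rule norm_projection_le[OF pq])
  have "K * q = (K - 2) * q + 2 *\<^sub>R q" by (simp add: algebra_simps mult_2 scaleR_2)
  then have "norm (K * q) \<le> norm ((K - 2) * q) + norm (2 *\<^sub>R q)" by (metis norm_triangle_ineq)
  then have nKq: "norm (K * q) \<le> 3" using Kq nq unfolding q_def w'_def by simp
  then have nqK: "norm (q * K) \<le> 3"
    using norm_star[of "K * q"] K by (simp add: star_mult sq self_adjoint_def)
  have nqKq: "norm (q * K * q) \<le> 3"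
    using norm_mult_ineq[of q "K * q"] mult_mono[OF nq nKq] by (simp add: mult.assoc)
  have "F * K * F = K - q * K - K * q + q * K * q"
    by (simp add: F_def algebra_simps KP PK)
  then have "x - T = (x * (1 - P) - K) + (x * P - P * x) * P + q * K + K * q - q * K * q - w - w'"
    by (simp add: T_def algebra_simps PP)
  \<comment> \<open>The summands contribute at most 7, 1 / 100, 3, 3, 3, 1 and 1.\<close>
  also have "norm \<dots> \<le> norm (x * (1 - P) - K) + norm ((x * P - P * x) * P) + norm (q * K)
      + norm (K * q) + norm (q * K * q) + norm w + norm w'"
    by (intro norm_triangle_le norm_triangle_le_diff add_mono order_refl)
  also have "norm ((x * P - P * x) * P) \<le> norm (x * P - P * x) * 1"
    by (rule order_trans[OF norm_mult_ineq]) (intro mult_left_mono norm_projection_le P norm_ge_zero)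
  finally have "norm (x - T) \<le> 20"
    using xK xP nqK nKq nqKq nw by (simp add: w'_def norm_star)
  moreover have "self_adjoint T"
    using x K by (simp add: T_def self_adjoint_def star_add star_mult sP sF w'_def star_star
        add.commute add.left_commute mult.assoc)
  ultimately show thesis using TS1 by (intro that)
qed

section \<open>Lifting from the sequence algebra\<close>

lemma apply_const_bcontfun [simp]: "apply_bcontfun (const_bcontfun a) n = a"
  by (simp add: const_bcontfun.rep_eq)

lemma const_seq_add: "const_seq (a + b) = const_seq a + const_seq b"
  unfolding const_seq_def plus_ainf.abs_eq
  by (rule arg_cong[where f = seq_class]) (auto intro!: bcontfun_eqI)

lemma const_seq_diff: "const_seq (a - b) = const_seq a - const_seq b"
  unfolding const_seq_def minus_ainf.abs_eq
  by (rule arg_cong[where f = seq_class]) (auto intro!: bcontfun_eqI)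

lemma const_seq_mult: "const_seq (a * b) = const_seq a * const_seq b"
  unfolding const_seq_def times_ainf.abs_eq
  by (rule arg_cong[where f = seq_class]) (auto intro!: bcontfun_eqI)

lemma const_seq_star: "const_seq (star a) = star (const_seq a)"
  unfolding const_seq_def star_ainf.abs_eq
  by (rule arg_cong[where f = seq_class]) (auto intro!: bcontfun_eqI)

lemma const_seq_scaleC: "const_seq (scaleC c a) = scaleC c (const_seq a)"
  unfolding const_seq_def scaleC_ainf.abs_eq
  by (rule arg_cong[where f = seq_class]) (auto intro!: bcontfun_eqI)

lemma const_seq_zero: "const_seq 0 = 0"
  using const_seq_diff[of 0 0] by simp

lemma const_seq_one: "const_seq 1 = 1"
  unfolding const_seq_def one_ainf.abs_eq
  by (rule arg_cong[where f = seq_class]) (auto intro!: bcontfun_eqI)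

lemma norm_const_seq_le: "norm (const_seq a) \<le> norm a"
  unfolding const_seq_def by (rule norm_seq_class_leI) simp

lemma has_null_subseq_const_seq: "has_null_subseq (const_seq a) \<longleftrightarrow> a = 0"
proof -
  have "(\<exists>k::nat \<Rightarrow> nat. strict_mono k) = True" using strict_mono_id by blast
  then show ?thesis
    by (simp add: const_seq_def has_null_subseq.abs_eq LIMSEQ_const_iff)
qed

text \<open>Average a representative with its adjoint.\<close>

lemma lift_self_adjoint:
  assumes "self_adjoint x"
  obtains X where "x = seq_class X" "\<And>n. self_adjoint (apply_bcontfun X n)"
proof -
  obtain Y where Y: "x = seq_class Y" by (rule ainf_cases)
  have "seq_class ((1 / 2) *\<^sub>R (Y + star Y)) = (1 / 2) *\<^sub>R (x + star x)"
    by (simp add: Y star_ainf.abs_eq plus_ainf.abs_eq scaleR_ainf.abs_eq)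
  also have "\<dots> = x" using assms by (simp add: self_adjoint_def scaleR_2[symmetric])
  finally show thesis
    by (intro that[of "(1 / 2) *\<^sub>R (Y + star Y)"])
      (simp_all add: self_adjoint_def star_scaleR star_add star_star add.commute)
qed

text \<open>The element b = 2 a - 1 is nearly a symmetry: b^2 = 1 - t with \<open>t\<close> small.
  Dividing by the root 1 - y of 1 - t gives an exact symmetry \<open>u\<close>, and (1 + u) / 2 is
  the projection. The bound 1 / 8 makes the norm of \<open>t\<close> at most 1 / 2, so that 1 - y is
  invertible.\<close>

lemma projection_near:
  fixes a :: "'a::unital_cstar_algebra"
  assumes a: "self_adjoint a" and a8: "norm (a * a - a) \<le> 1 / 8"
  obtains p where "projection p" "norm (p - a) \<le> 2 * norm (a * a - a)"
proof -
  define b where "b = 2 *\<^sub>R a - 1"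
  define t where "t = 4 *\<^sub>R (a - a * a)"
  have t: "self_adjoint t" "norm t = 4 * norm (a * a - a)"
    by (auto simp: t_def norm_minus_commute intro!: self_adjoint_intros self_adjoint_mult a)
  have bb: "b * b = 1 - t" by (simp add: b_def t_def algebra_simps scaleR_2[symmetric])
  have sb: "self_adjoint b" unfolding b_def by (intro self_adjoint_intros a)
  have "norm t \<le> 1" using t(2) a8 by simp
  then obtain y where y: "self_adjoint y" "norm y \<le> norm t" "(1 - y) * (1 - y) = 1 - t" "bicomm t y"
    using sqrt_one_minus[OF t(1)] by metis
  have "norm (1 - (1 - y)) < 1" using y(2) t(2) a8 by simp
  then obtain d where d: "(1 - y) * d = 1" "d * (1 - y) = 1" by (rule inverse_near_one)
  have "b * t = t * b" by (simp add: b_def t_def algebra_simps)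
  then have "b * y = y * b" by (rule bicommD[OF y(4)])
  then have "b * (1 - y) = (1 - y) * b" by (simp add: algebra_simps)
  then have bd: "b * d = d * b" by (rule inverse_commute[OF d])
  have sd: "self_adjoint d" by (rule inverse_self_adjoint[OF d]) (intro self_adjoint_intros y)
  define u where "u = b * d"
  have su: "self_adjoint u" unfolding u_def by (rule self_adjoint_mult[OF sb sd bd])
  have "u * u = (b * b) * (d * d)" unfolding u_def by (metis bd mult.assoc)
  also have "\<dots> = 1" unfolding bb y(3)[symmetric] by (metis d mult.assoc mult_1_left)
  finally have uu: "u * u = 1" .
  have "(norm u)\<^sup>2 = 1" using norm_self_adjoint_square[OF su] uu by simp
  then have nu: "norm u = 1" by (simp add: power2_eq_1_iff) (smt (verit) norm_ge_zero)
  have "b = u * (1 - y)" by (simp add: u_def mult.assoc d)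
  then have ub: "u - b = u * y" by (simp add: algebra_simps)
  define p where "p = (1 / 2) *\<^sub>R (1 + u)"
  show thesis
  proof (rule that[of p])
    have "(1 + u) * (1 + u) = 2 *\<^sub>R (1 + u)"
      unfolding distrib_left distrib_right uu by (simp add: scaleR_2)
    then have "p * p = p" by (simp add: p_def)
    moreover have "self_adjoint p" unfolding p_def by (intro self_adjoint_intros su)
    ultimately show "projection p" by (simp add: projection_def)
    have "p - a = (1 / 2) *\<^sub>R (u - b)" by (simp add: p_def b_def algebra_simps)
    then have "norm (p - a) = norm (u * y) / 2" by (simp add: ub)
    also have "norm (u * y) \<le> norm y" using norm_mult_ineq[of u y] nu by simp
    finally show "norm (p - a) \<le> 2 * norm (a * a - a)" using y(2) t(2) by simp
  qed
qed

lemma lift_projection: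
  fixes g :: "'a::unital_cstar_algebra ainf"
  assumes g: "projection g"
  obtains X where "g = seq_class X" "\<And>n. projection (apply_bcontfun X n)"
proof -
  obtain G where G: "g = seq_class G" "\<And>n. self_adjoint (apply_bcontfun G n)"
    using g lift_self_adjoint[of g] by (auto simp: projection_def)
  have "seq_class (G * G) = seq_class G"
    using g by (simp add: projection_def G(1) times_ainf.abs_eq)
  then have lim: "(\<lambda>n. apply_bcontfun (G * G - G) n) \<longlonglongrightarrow> 0"
    by (simp add: seq_class_eq_iff null_seqs_iff)
  \<comment> \<open>Where the bound 1 / 8 fails, which happens for finitely many \<open>n\<close>
    only, the projection 0 is inserted.\<close>
  have "\<exists>p. projection p \<and> (norm (apply_bcontfun (G * G - G) n) \<le> 1 / 8 \<longrightarrow>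
      norm (p - apply_bcontfun G n) \<le> 2 * norm (apply_bcontfun (G * G - G) n))" for n
  proof (cases "norm (apply_bcontfun (G * G - G) n) \<le> 1 / 8")
    case True
    then show ?thesis using projection_near[OF G(2), of n] by auto
  next
    case False
    then show ?thesis by (auto intro!: exI[of _ 0] simp: projection_def self_adjoint_def star_zero)
  qed
  then obtain p where p: "\<And>n. projection (p n)"
      "\<And>n. norm (apply_bcontfun (G * G - G) n) \<le> 1 / 8 \<Longrightarrow>
      norm (p n - apply_bcontfun G n) \<le> 2 * norm (apply_bcontfun (G * G - G) n)"
    by metis
  have pb: "p \<in> bcontfun" by (rule bcontfun_normI[of _ 1]) (simp_all add: norm_projection_le p(1))
  have "\<forall>\<^sub>F n in sequentially. norm (apply_bcontfun (G * G - G) n) < 1 / 8"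
    using tendstoD[OF lim, of "1 / 8"] by simp
  then have "\<forall>\<^sub>F n in sequentially. norm (apply_bcontfun (Bcontfun p - G) n)
      \<le> norm (apply_bcontfun (G * G - G) n) * 2"
    by eventually_elim (use p(2) in \<open>simp add: Bcontfun_inverse[OF pb] mult.commute\<close>)
  from tendsto_0_le[OF lim this] have "seq_class (Bcontfun p) = g"
    by (simp add: G(1) seq_class_eq_iff null_seqs_iff)
  then show thesis by (intro that[of "Bcontfun p"]) (simp_all add: Bcontfun_inverse[OF pb] p(1))
qed

text \<open>Both strict inequalities persist at late terms of representing sequences. The second
  gives a right inverse there, and its adjoint is a left inverse because the term is
  self-adjoint.\<close>

lemma lift_invertible:
  fixes x :: "'a::unital_cstar_algebra"
  assumes T: "self_adjoint T" and xT: "norm (const_seq x - T) < r" and TS: "norm (T * S - 1) < 1"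
  obtains y where "self_adjoint y" "invertible_element y" "norm (x - y) < r"
proof -
  obtain X where X: "T = seq_class X" "\<And>n. self_adjoint (apply_bcontfun X n)"
    using lift_self_adjoint[OF T] by metis
  obtain Y where Y: "S = seq_class Y" by (rule ainf_cases)
  have "\<forall>\<^sub>F n in sequentially. norm (apply_bcontfun (const_bcontfun x - X) n) < r"
    by (rule eventually_norm_less) (use xT in \<open>simp add: X(1) const_seq_def minus_ainf.abs_eq\<close>)
  moreover have "\<forall>\<^sub>F n in sequentially. norm (apply_bcontfun (X * Y - 1) n) < 1"
    by (rule eventually_norm_less)
      (use TS in \<open>simp add: X(1) Y times_ainf.abs_eq one_ainf.abs_eq minus_ainf.abs_eq\<close>)
  ultimately have "\<forall>\<^sub>F n in sequentially. norm (x - apply_bcontfun X n) < r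
      \<and> norm (apply_bcontfun X n * apply_bcontfun Y n - 1) < 1"
    by eventually_elim simp
  then obtain n where n: "norm (x - apply_bcontfun X n) < r"
      "norm (apply_bcontfun X n * apply_bcontfun Y n - 1) < 1"
    by (auto simp: eventually_sequentially)
  define y s where "y = apply_bcontfun X n" and "s = apply_bcontfun Y n"
  have sy: "star y = y" using X(2) by (simp add: y_def self_adjoint_def)
  have "norm (1 - y * s) < 1" using n(2) by (simp add: y_def s_def norm_minus_commute)
  then obtain d where d: "y * s * d = 1" by (rule inverse_near_one)
  then have r: "y * (s * d) = 1" by (simp add: mult.assoc)
  have l: "star (s * d) * y = 1" using arg_cong[OF r, of star] by (simp add: star_mult[of y] sy star_one)
  have "star (s * d) = s * d" by (metis l r mult.assoc mult_1_left mult_1_right)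
  then have "invertible_element y" using l r by (auto simp: invertible_element_def)
  then show thesis using n(1) X(2) by (intro that[of y]) (simp_all add: y_def)
qed

text \<open>Here \<open>z = 2 max (y - l) 0\<close> and \<open>R = 1 / (l + \<bar>y - l\<bar>)\<close>.\<close>

lemma cut_down:
  fixes y :: "'a::unital_cstar_algebra"
  assumes y: "psd y" and l: "0 < l" "l < norm y"
  obtains z R where "self_adjoint z" "z \<noteq> 0" "R * y * z = z" "norm R \<le> 1 / l"
    "\<And>c. c * y = y * c \<Longrightarrow> c * R = R * c"
proof -
  define s where "s = y - of_real l"
  have s: "self_adjoint s" unfolding s_def by (intro self_adjoint_intros psd_self_adjoint[OF y])
  obtain b where b: "psd b" "b * b = s * s" "bicomm (s * s) b"
    using psd_sqrt[OF psd_square[OF s]] by metis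
  have cb: "c * b = b * c" if "c * y = y * c" for c
  proof (rule bicommD[OF b(3)])
    have "c * s = s * c" by (simp add: s_def algebra_simps that of_real_def)
    then show "c * (s * s) = s * s * c" by (metis mult.assoc)
  qed
  have yb: "y * b = b * y" by (rule cb) simp
  have sb: "s * b = b * s" by (simp add: s_def algebra_simps yb of_real_def)
  define z where "z = s + b"
  have bl: "psd ((1 / l) *\<^sub>R b)" by (rule psd_scaleR[OF b(1)]) (use l in simp)
  obtain D where D: "D * (1 + (1 / l) *\<^sub>R b) = 1" "norm D \<le> 1"
      "\<And>c. c * ((1 / l) *\<^sub>R b) = (1 / l) *\<^sub>R b * c \<Longrightarrow> c * D = D * c"
    using psd_one_plus_inverse[OF bl] by metis
  \<comment> \<open>As b^2 = s^2, the elements \<open>b\<close> and \<open>s\<close> agree on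
    \<open>z\<close>. So \<open>y = l + s\<close> acts on \<open>z\<close> as l + b, whose inverse
    is D / l.\<close>
  have "(b - s) * z = 0" by (simp add: z_def algebra_simps b(2) sb)
  then have "y * z = (of_real l + b) * z" by (simp add: s_def algebra_simps)
  also have "of_real l + b = l *\<^sub>R (1 + (1 / l) *\<^sub>R b)" using l by (simp add: scaleR_add_right of_real_def)
  finally have yz: "y * z = l *\<^sub>R ((1 + (1 / l) *\<^sub>R b) * z)" by simp
  show thesis
  proof (rule that[of z "(1 / l) *\<^sub>R D"])
    show "self_adjoint z" unfolding z_def by (intro self_adjoint_add s psd_self_adjoint[OF b(1)])
    show "z \<noteq> 0"
    proof
      assume "z = 0"
      \<comment> \<open>Both summands are positive and commute, so the norm of \<open>y\<close>
        would be at most \<open>l\<close>.\<close>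
      then have "y + b = of_real l" by (simp add: z_def s_def algebra_simps)
      then show False using psd_norm_le_add[OF y b(1) yb] l by simp
    qed
    have "D * (y * z) = l *\<^sub>R z" unfolding yz using D(1) by (simp add: mult.assoc[symmetric])
    then show "(1 / l) *\<^sub>R D * y * z = z" using l by (simp add: mult.assoc)
    show "norm ((1 / l) *\<^sub>R D) \<le> 1 / l" using D(2) l by (simp add: divide_simps)
    show "c * ((1 / l) *\<^sub>R D) = (1 / l) *\<^sub>R D * c" if "c * y = y * c" for c
      using D(3)[of c] cb[OF that] by simp
  qed
qed

section \<open>The two splittings\<close>

lemma norm_mult_le:
  fixes a b :: "'a::real_normed_algebra"
  assumes "norm a \<le> r" "norm b \<le> s"
  shows "norm (a * b) \<le> r * s"
proof -
  have "0 \<le> r" using assms(1) norm_ge_zero order_trans by blast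
  then have "norm a * norm b \<le> r * s" using assms by (intro mult_mono) auto
  then show ?thesis using norm_mult_ineq[of a b] by linarith
qed

text \<open>The first splitting at a finite stage: \<open>p\<close>, \<open>c\<close>,
  \<open>e\<close>, \<open>M\<close> are terms of sequences representing \<open>g\<close>, \<psi> k,
  \<psi> j, \<psi> N. The order of quantifiers matters: the lower bound \<nu> for p z p is fixed
  before the precision \<theta>, so \<theta> can later be chosen in terms of \<nu>.\<close>

lemma split_corner_approximation:
  fixes \<phi> :: "'a::unital_cstar_algebra \<Rightarrow> 'b::unital_cstar_algebra"
  assumes simple: "simple_cstar TYPE('a)"
    and \<psi>: "star_hom \<psi>" and g: "projection g" "g \<noteq> 0" "g \<in> central_sequences"
    and \<psi>\<phi>: "\<And>a. \<psi> (\<phi> a) = const_seq a * g" and \<phi>1: "\<phi> 1 = 1"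
    and z: "z \<noteq> 0"
    and k: "self_adjoint k" "k * j = 1" and j: "norm j \<le> 1" and kx: "norm (k - \<phi> x) \<le> 3"
    and N: "norm N \<le> 3" and kN: "norm (k - 2 - N * \<phi> x) \<le> \<eta>" and \<eta>: "0 < \<eta>"
  obtains \<nu> where "0 < \<nu>"
    and "\<And>\<theta>. 0 < \<theta> \<Longrightarrow> \<exists>p c e M. projection p \<and> self_adjoint c \<and> p * c = c
      \<and> norm (c * e - p) < \<theta> \<and> norm e < 2 \<and> norm (c - x * p) < 4 \<and> norm M < 4
      \<and> norm (c - 2 * p - M * x) < 2 * \<eta> \<and> norm (p * x - x * p) < \<theta> \<and> \<nu> < norm (p * z * p)"
proof -
  have add: "\<psi> (a + b) = \<psi> a + \<psi> b" and mult: "\<psi> (a * b) = \<psi> a * \<psi> b"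
    and st: "\<psi> (star a) = star (\<psi> a)" for a b
    using \<psi> by (auto simp: star_hom_def)
  have diff: "\<psi> (a - b) = \<psi> a - \<psi> b" for a b using add[of "a - b" b] by simp
  have \<psi>1: "\<psi> 1 = g" using \<psi>\<phi>[of 1] by (simp add: \<phi>1 const_seq_one)
  have gl: "g * \<psi> b = \<psi> b" and gr: "\<psi> b * g = \<psi> b" for b
    by (simp_all add: \<psi>1[symmetric] mult[symmetric])
  have two: "\<psi> 2 = 2 * g" using add[of 1 1] by (simp add: \<psi>1 mult_2)
  have cg: "g * const_seq a = const_seq a * g" for a using g(3) by (simp add: central_sequences_def)
  have gg: "g * g = g" using g(1) by (simp add: projection_def)
  have con: "norm (\<psi> b) \<le> norm b" for b by (rule star_hom_contractive[OF \<psi>])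
  \<comment> \<open>The elements whose product with the central projection \<open>g\<close> vanishes
    form a closed ideal without 1, so simplicity leaves only 0.\<close>
  have zg: "const_seq z * g \<noteq> 0"
  proof
    define I where "I = {a. const_seq a * g = 0}"
    assume "const_seq z * g = 0"
    then have "z \<in> I" by (simp add: I_def)
    have "bounded_linear (\<lambda>a. const_seq a * g)"
    proof (rule bounded_linear_intro[where K = "norm g"])
      show "const_seq (a + b) * g = const_seq a * g + const_seq b * g" for a b
        by (simp add: const_seq_add distrib_right)
      show "const_seq (r *\<^sub>R a) * g = r *\<^sub>R (const_seq a * g)" for r a
        by (simp add: scaleC_of_real[symmetric] const_seq_scaleC mult_scaleC_left)
      show "norm (const_seq a * g) \<le> norm a * norm g" for a
        using norm_mult_ineq[of "const_seq a" g] mult_right_mono[OF norm_const_seq_le norm_ge_zero]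
        by (rule order_trans)
    qed
    then have "continuous_on UNIV (\<lambda>a. const_seq a * g)"
      by (rule linear_continuous_on)
    then have "closed I" unfolding I_def by (intro closed_Collect_eq continuous_on_const)
    moreover have "const_seq (scaleC c a) * g = scaleC c (const_seq a * g)" for c a
      by (simp add: const_seq_scaleC mult_scaleC_left)
    moreover have "scaleC c 0 = (0 :: 'a ainf)" for c
      using bounded_linear.linear[OF bounded_linear_scaleC] by (rule linear_0)
    moreover have "const_seq (a * b) * g = const_seq a * (const_seq b * g)"
      "const_seq (a * b) * g = (const_seq a * g) * const_seq b" for a b
      by (simp_all add: const_seq_mult mult.assoc cg)
    ultimately have "closed_ideal I"
      by (auto simp: closed_ideal_def I_def const_seq_zero const_seq_add distrib_right)
        (metis mult_zero_right mult_zero_left)+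
    then have "I = {0} \<or> I = UNIV" using simple by (auto simp: simple_cstar_def)
    moreover have "1 \<notin> I" using g(2) by (simp add: I_def const_seq_one)
    ultimately show False using \<open>z \<in> I\<close> \<open>z \<noteq> 0\<close> by auto
  qed
  obtain G where G: "g = seq_class G" "\<And>n. projection (apply_bcontfun G n)"
    using lift_projection[OF g(1)] by metis
  have "self_adjoint (\<psi> k)" using k(1) by (simp add: self_adjoint_def st[symmetric])
  then obtain K where K: "\<psi> k = seq_class K" "\<And>n. self_adjoint (apply_bcontfun K n)"
    using lift_self_adjoint by metis
  obtain J where J: "\<psi> j = seq_class J" by (rule ainf_cases)
  obtain M where M: "\<psi> N = seq_class M" by (rule ainf_cases)
  define X :: "(nat, 'a) bcontfun" where "X = const_bcontfun x"
  define Z :: "(nat, 'a) bcontfun" where "Z = const_bcontfun z"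
  \<comment> \<open>Compressing by \<open>G\<close> still represents \<psi> k, since g (\<psi> k) g
    = \<psi> k, and puts every term exactly into the corner of the corresponding projection.\<close>
  define C where "C = G * K * G"
  have X: "seq_class X = const_seq x" and Z: "seq_class Z = const_seq z"
    by (simp_all add: X_def Z_def const_seq_def)
  have C: "seq_class C = \<psi> k"
    by (simp add: C_def times_ainf.abs_eq[symmetric] G(1)[symmetric] K(1)[symmetric] gl gr)
  define \<nu> where "\<nu> = norm (const_seq z * g) / 2"
  have \<nu>: "0 < \<nu>" using zg by (simp add: \<nu>_def)
  note cls = times_ainf.abs_eq[symmetric] minus_ainf.abs_eq[symmetric] plus_ainf.abs_eq[symmetric]
    G(1)[symmetric] K(1)[symmetric] J[symmetric] M[symmetric] X Z C
  show thesis
  proof (rule that[OF \<nu>])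
    fix \<theta> :: real assume \<theta>: "0 < \<theta>"
    have "norm (seq_class (C * J - G)) < \<theta>"
      using \<theta> by (simp add: cls mult[symmetric] k \<psi>1)
    from eventually_norm_less[OF this]
    have 1: "\<forall>\<^sub>F n in sequentially. norm (apply_bcontfun (C * J - G) n) < \<theta>" .
    have "norm (seq_class J) < 2" using con[of j] j by (simp add: cls)
    from eventually_norm_less[OF this]
    have 2: "\<forall>\<^sub>F n in sequentially. norm (apply_bcontfun J n) < 2" .
    have "norm (seq_class (C - X * G)) < 4"
      using con[of "k - \<phi> x"] kx by (simp add: cls diff \<psi>\<phi>)
    from eventually_norm_less[OF this]
    have 3: "\<forall>\<^sub>F n in sequentially. norm (apply_bcontfun (C - X * G) n) < 4" .
    have "norm (seq_class M) < 4" using con[of N] N by (simp add: cls)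
    from eventually_norm_less[OF this]
    have 4: "\<forall>\<^sub>F n in sequentially. norm (apply_bcontfun M n) < 4" .
    have "\<psi> N * const_seq x = \<psi> N * (const_seq x * g)" by (metis cg gr mult.assoc)
    then have "seq_class (C - (G + G) - M * X) = \<psi> (k - 2 - N * \<phi> x)"
      by (simp add: cls diff two mult \<psi>\<phi> mult_2)
    then have "norm (seq_class (C - (G + G) - M * X)) < 2 * \<eta>"
      using con[of "k - 2 - N * \<phi> x"] kN \<eta> by simp
    from eventually_norm_less[OF this]
    have 5: "\<forall>\<^sub>F n in sequentially. norm (apply_bcontfun (C - (G + G) - M * X) n) < 2 * \<eta>" .
    have "norm (seq_class (G * X - X * G)) < \<theta>" using \<theta> by (simp add: cls cg)
    from eventually_norm_less[OF this]
    have 6: "\<forall>\<^sub>F n in sequentially. norm (apply_bcontfun (G * X - X * G) n) < \<theta>" .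
    have "seq_class (G * Z * G) = const_seq z * g" by (simp add: cls cg) (simp add: mult.assoc gg)
    then have "\<not> norm (seq_class (G * Z * G)) \<le> \<nu>" using \<nu> by (simp add: \<nu>_def)
    then have "\<not> (\<forall>\<^sub>F n in sequentially. norm (apply_bcontfun (G * Z * G) n) \<le> \<nu>)"
      using norm_seq_class_leI by blast
    \<comment> \<open>The lower bound is available for infinitely many \<open>n\<close> only. The
      other six estimates hold eventually, so a common index exists.\<close>
    then have 7: "\<exists>\<^sub>F n in sequentially. \<nu> < norm (apply_bcontfun (G * Z * G) n)"
      by (simp add: not_eventually not_le)
    from eventually_conj[OF 1 eventually_conj[OF 2 eventually_conj[OF 3 eventually_conj[OF 4
          eventually_conj[OF 5 6]]]]]
    have "\<exists>\<^sub>F n in sequentially. \<nu> < norm (apply_bcontfun (G * Z * G) n) \<and>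
       (norm (apply_bcontfun (C * J - G) n) < \<theta> \<and> norm (apply_bcontfun J n) < 2 \<and>
        norm (apply_bcontfun (C - X * G) n) < 4 \<and> norm (apply_bcontfun M n) < 4 \<and>
        norm (apply_bcontfun (C - (G + G) - M * X) n) < 2 * \<eta> \<and>
        norm (apply_bcontfun (G * X - X * G) n) < \<theta>)"
      by (rule frequently_eventually_frequently[OF 7])
    then obtain n where n: "\<nu> < norm (apply_bcontfun (G * Z * G) n)"
      "norm (apply_bcontfun (C * J - G) n) < \<theta>" "norm (apply_bcontfun J n) < 2"
      "norm (apply_bcontfun (C - X * G) n) < 4" "norm (apply_bcontfun M n) < 4"
      "norm (apply_bcontfun (C - (G + G) - M * X) n) < 2 * \<eta>"
      "norm (apply_bcontfun (G * X - X * G) n) < \<theta>"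
      using frequently_ex by blast
    define p where "p = apply_bcontfun G n"
    have p: "projection p" "star p = p" "p * p = p"
      using G(2)[of n] by (auto simp: p_def projection_def self_adjoint_def)
    define c e where "c = apply_bcontfun C n" and "e = apply_bcontfun J n"
    have "self_adjoint c"
      using K(2)[of n] p(2)
      by (simp add: c_def C_def self_adjoint_def star_mult p_def mult.assoc)
    moreover have "p * c = c"
      using p(3) by (simp add: c_def C_def p_def mult.assoc[symmetric])
    moreover have "norm (c * e - p) < \<theta>" "norm e < 2" "norm (c - x * p) < 4"
        "norm (c - 2 * p - apply_bcontfun M n * x) < 2 * \<eta>" "norm (p * x - x * p) < \<theta>"
        "\<nu> < norm (p * z * p)"
      using n by (simp_all only: c_def e_def p_def X_def Z_def mult_2 apply_bcontfun_times
          plus_bcontfun.rep_eq minus_bcontfun.rep_eq apply_const_bcontfun)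
    ultimately show "\<exists>p c e M. projection p \<and> self_adjoint c \<and> p * c = c
      \<and> norm (c * e - p) < \<theta> \<and> norm e < 2 \<and> norm (c - x * p) < 4 \<and> norm M < 4
      \<and> norm (c - 2 * p - M * x) < 2 * \<eta> \<and> norm (p * x - x * p) < \<theta> \<and> \<nu> < norm (p * z * p)"
      using p(1) n(5) by blast
  qed
qed

text \<open>The second splitting verifies the hypotheses of \<open>corner_perturbation\<close>. With
  h = 1 - g, the element \<open>K\<close> is \<psi> k on \<open>g\<close> and \<open>c\<close> on
  \<open>h\<close>; it is almost inverted on g + p h = 1 - P. Both parts differ from 2 by
  approximate left multiples of \<open>x\<close>, and \<open>x\<close> is small on the range of
  \<open>v\<close>.\<close>

lemma split_perturbation:
  fixes \<phi> :: "'a::unital_cstar_algebra \<Rightarrow> 'b::unital_cstar_algebra"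
  assumes \<psi>: "star_hom \<psi>" and g: "projection g" "g \<in> central_sequences"
    and \<psi>\<phi>: "\<And>a. \<psi> (\<phi> a) = const_seq a * g" and \<phi>1: "\<phi> 1 = 1"
    and x: "self_adjoint x"
    and k: "self_adjoint k" "k * j = 1" and j: "norm j \<le> 1" and kx: "norm (k - \<phi> x) \<le> 3"
    and N: "norm N \<le> 3" and kN: "norm (k - 2 - N * \<phi> x) \<le> 1 / 100"
    and p: "projection p" and c: "self_adjoint c" "p * c = c" and e: "norm e \<le> 2"
    and ce: "norm (c * e - p) \<le> 1 / 100" and cx: "norm (c - x * p) \<le> 4"
    and M: "norm M \<le> 4" and cM: "norm (c - 2 * p - M * x) \<le> 1 / 50"
    and px: "norm (p * x - x * p) \<le> 1 / 100"
    and v: "star v * v = 1 - g" and q: "projection (v * star v)"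
    and pq: "const_seq p * (v * star v) = v * star v"
    and xq: "norm (const_seq x * (v * star v)) \<le> 1 / 200"
  obtains T S where "self_adjoint T" "norm (const_seq x - T) \<le> 20" "norm (T * S - 1) < 1"
proof -
  have add: "\<psi> (a + b) = \<psi> a + \<psi> b" and mult: "\<psi> (a * b) = \<psi> a * \<psi> b"
    and st: "\<psi> (star a) = star (\<psi> a)" for a b
    using \<psi> by (auto simp: star_hom_def)
  have diff: "\<psi> (a - b) = \<psi> a - \<psi> b" for a b using add[of "a - b" b] by simp
  have \<psi>1: "\<psi> 1 = g" using \<psi>\<phi>[of 1] by (simp add: \<phi>1 const_seq_one)
  have gl: "g * \<psi> b = \<psi> b" and gr: "\<psi> b * g = \<psi> b" for b
    by (simp_all add: \<psi>1[symmetric] mult[symmetric])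
  have two: "\<psi> 2 = 2 * g" using add[of 1 1] by (simp add: \<psi>1 mult_2)
  have con: "norm (\<psi> b) \<le> norm b" for b by (rule star_hom_contractive[OF \<psi>])
  have pp: "p * p = p" and sp: "star p = p" using p by (auto simp: projection_def self_adjoint_def)
  define h where "h = 1 - g"
  have h: "projection h" unfolding h_def by (rule projection_one_minus[OF g(1)])
  have hh: "h * h = h" and sh: "star h = h" using h by (auto simp: projection_def self_adjoint_def)
  have ch: "h * const_seq a = const_seq a * h" for a
    using g(2) by (simp add: h_def central_sequences_def left_diff_distrib right_diff_distrib)
  have cg: "g * const_seq a = const_seq a * g" for a using g(2) by (simp add: central_sequences_def)
  have h\<psi>: "h * \<psi> b = 0" "\<psi> b * h = 0" for b
    by (simp_all add: h_def left_diff_distrib right_diff_distrib gl gr)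
  define u where "u = const_seq p"
  have uu: "u * u = u" by (simp add: u_def const_seq_mult[symmetric] pp)
  have su: "star u = u" by (simp add: u_def const_seq_star[symmetric] sp)
  have hu: "h * u = u * h" by (simp add: u_def ch)
  define P where "P = (1 - u) * h"
  have sP: "star P = P" by (simp add: P_def star_mult star_diff star_one su sh algebra_simps hu)
  have hu': "h * (1 - u) = (1 - u) * h" by (simp add: algebra_simps hu)
  have uu': "(1 - u) * (1 - u) = 1 - u" by (simp add: algebra_simps uu)
  have PP: "P * P = P" unfolding P_def by (metis hu' uu' hh mult.assoc)
  have P: "projection P" using sP PP by (simp add: projection_def self_adjoint_def)
  have hP: "h * P = P" unfolding P_def by (metis hu' hh mult.assoc)
  have "(1 - u) * u = 0" by (simp add: algebra_simps uu)
  then have Pu: "P * u = 0" unfolding P_def by (metis hu mult.assoc mult_zero_left)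
  have Ph: "1 - P = g + u * h" by (simp add: P_def h_def algebra_simps)
  define w where "w = v * P"
  have vh: "v * h = v" using partial_isometry_source[OF h] v by (simp add: h_def)
  \<comment> \<open>Multiplying \<open>pq\<close> by \<open>v\<close> on the right turns the
    statement about the range projection into one about \<open>v\<close>. Together with P u = 0 it
    gives P w = 0.\<close>
  have uv: "u * v = v"
    by (metis pq u_def v vh h_def mult.assoc)
  have ww: "star w * w = P"
    by (metis w_def star_mult sP mult.assoc v h_def hP PP)
  have Pw: "P * w = 0" unfolding w_def by (metis uv Pu mult.assoc mult_zero_left)
  define q where "q = w * star w"
  have nw: "norm w \<le> 1"
  proof -
    have "(norm w)\<^sup>2 \<le> 1" using cstar_identity[of w] ww norm_projection_le[OF P] by simp
    then show ?thesis by (simp add: abs_square_le_1)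
  qed
  have "norm q \<le> norm w * norm w" unfolding q_def using norm_mult_ineq[of w "star w"] by (simp add: norm_star)
  also have "\<dots> \<le> 1" using nw by (simp add: mult_le_one)
  finally have nq: "norm q \<le> 1" .
  have vq: "v * star v * q = q" unfolding q_def w_def by (metis v vh h_def mult.assoc)
  have "norm (const_seq x * (v * star v) * q) \<le> 1 / 200 * 1"
    by (rule norm_mult_le[OF xq nq])
  then have xq': "norm (const_seq x * q) \<le> 1 / 200" using vq by (simp add: mult.assoc)
  have Pq: "P * q = 0" unfolding q_def by (simp add: mult.assoc[symmetric] Pw)
  define K where "K = \<psi> k + const_seq c * h"
  define J where "J = \<psi> j + const_seq e * h"
  define y where "y = const_seq x"
  have nh: "norm (a * h) \<le> norm a" for a
    using norm_mult_ineq[of a h] mult_left_mono[OF norm_projection_le[OF h] norm_ge_zero[of a]] by simp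
  have uc: "u * const_seq c = const_seq c" by (simp add: u_def const_seq_mult[symmetric] c)
  show thesis
  proof (rule corner_perturbation[of y K P w J])
    show "self_adjoint y" using x by (simp add: y_def self_adjoint_def const_seq_star[symmetric])
    show "self_adjoint K"
      using k c by (simp add: K_def self_adjoint_def star_add star_mult st[symmetric]
          const_seq_star[symmetric] sh ch)
    show "projection P" "star w * w = P" "P * w = 0" by (fact P ww Pw)+
    have "(1 - u) * const_seq c = 0" by (simp add: left_diff_distrib uc)
    moreover have "P * (const_seq c * h) = (1 - u) * (h * const_seq c) * h"
      by (simp only: P_def mult.assoc)
    then have "P * (const_seq c * h) = ((1 - u) * const_seq c) * (h * h)"
      unfolding ch by (simp only: mult.assoc)
    ultimately have "P * (const_seq c * h) = 0" by (simp only: mult_zero_left)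
    moreover have "P * \<psi> k = 0" by (simp add: P_def mult.assoc h\<psi>)
    ultimately show "P * K = 0" by (simp add: K_def distrib_left)
    \<comment> \<open>The cross terms of K J vanish: images of \<psi> live on \<open>g\<close>, the
      other summands on \<open>h\<close>.\<close>
    have "\<psi> k * (const_seq e * h) = 0"
      unfolding ch[symmetric] by (simp only: mult.assoc[symmetric] h\<psi> mult_zero_left)
    moreover have "const_seq c * h * \<psi> j = 0" by (simp add: mult.assoc h\<psi>)
    moreover have "const_seq c * h * (const_seq e * h) = const_seq (c * e) * h"
      using arg_cong[OF ch[of e], of "\<lambda>a. const_seq c * a * h"]
      by (simp only: const_seq_mult mult.assoc hh)
    ultimately have "K * J = \<psi> (k * j) + const_seq (c * e) * h"
      by (simp add: K_def J_def distrib_left distrib_right mult)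
    then have "K * J - (1 - P) = const_seq (c * e - p) * h"
      by (simp add: Ph k \<psi>1 const_seq_diff u_def left_diff_distrib)
    then show "norm (K * J - (1 - P)) \<le> 1 / 100"
      using nh[of "const_seq (c * e - p)"] norm_const_seq_le[of "c * e - p"] ce by simp
    show "norm J \<le> 3"
      unfolding J_def using norm_triangle_ineq[of "\<psi> j" "const_seq e * h"] con[of j] j
        nh[of "const_seq e"] norm_const_seq_le[of e] e by simp
    have "y * (1 - P) - K = - (\<psi> (k - \<phi> x) + const_seq (c - x * p) * h)"
      by (simp add: Ph K_def y_def u_def diff \<psi>\<phi> const_seq_diff const_seq_mult algebra_simps)
    then have "norm (y * (1 - P) - K) = norm (\<psi> (k - \<phi> x) + const_seq (c - x * p) * h)"
      by (simp only: norm_minus_cancel)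
    then show "norm (y * (1 - P) - K) \<le> 7"
      using norm_triangle_ineq[of "\<psi> (k - \<phi> x)" "const_seq (c - x * p) * h"] con[of "k - \<phi> x"] kx
        nh[of "const_seq (c - x * p)"] norm_const_seq_le[of "c - x * p"] cx by simp
    have "y * P - P * y = const_seq (p * x - x * p) * h"
      by (simp add: P_def y_def u_def const_seq_diff const_seq_mult algebra_simps ch)
    then show "norm (y * P - P * y) \<le> 1 / 100"
      using nh[of "const_seq (p * x - x * p)"] norm_const_seq_le[of "p * x - x * p"] px by simp
    \<comment> \<open>Since P q = 0, the scalar 2 on \<open>q\<close> splits as 2 g + 2 u h,
      matching the two summands of \<open>K\<close>.\<close>
    have "q = g * q + u * h * q" using Pq arg_cong[OF Ph, of "\<lambda>a. a * q"]
      by (simp add: left_diff_distrib distrib_right)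
    then have "(K - 2) * q = K * q - 2 * (g * q + u * h * q)" by (simp add: left_diff_distrib)
    also have "\<dots> = (\<psi> k - 2 * g) * q + h * (const_seq c - 2 * u) * q"
      by (simp add: K_def algebra_simps ch hu mult_2 mult_2_right)
    also have "\<psi> k - 2 * g = \<psi> (k - 2 - N * \<phi> x) + \<psi> N * y"
    proof -
      have "\<psi> N * (y * g) = \<psi> N * y" by (metis y_def cg gr mult.assoc)
      then show ?thesis by (simp add: diff mult \<psi>\<phi> two y_def)
    qed
    also have "const_seq c - 2 * u = const_seq (c - 2 * p - M * x) + const_seq M * y"
      by (simp add: const_seq_diff const_seq_mult const_seq_add u_def y_def mult_2)
    finally have eq: "(K - 2) * q = \<psi> (k - 2 - N * \<phi> x) * q + \<psi> N * (y * q)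
        + h * (const_seq (c - 2 * p - M * x) * q + const_seq M * (y * q))"
      by (simp add: algebra_simps)
    have b1: "norm (\<psi> (k - 2 - N * \<phi> x) * q) \<le> 1 / 100 * 1"
      by (rule norm_mult_le[OF order_trans[OF con kN] nq])
    have b2: "norm (\<psi> N * (y * q)) \<le> 3 * (1 / 200)"
      unfolding y_def by (rule norm_mult_le[OF order_trans[OF con N] xq'])
    have b3: "norm (const_seq (c - 2 * p - M * x) * q) \<le> 1 / 50 * 1"
      by (rule norm_mult_le[OF order_trans[OF norm_const_seq_le cM] nq])
    have b4: "norm (const_seq M * (y * q)) \<le> 4 * (1 / 200)"
      unfolding y_def by (rule norm_mult_le[OF order_trans[OF norm_const_seq_le M] xq'])
    have b5: "norm (h * (const_seq (c - 2 * p - M * x) * q + const_seq M * (y * q)))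
        \<le> 1 * (1 / 50 * 1 + 4 * (1 / 200))"
      by (rule norm_mult_le[OF norm_projection_le[OF h]])
        (rule order_trans[OF norm_triangle_ineq add_mono[OF b3 b4]])
    have "norm ((K - 2) * q)
        \<le> 1 / 100 * 1 + 3 * (1 / 200) + 1 * (1 / 50 * 1 + 4 * (1 / 200))"
      unfolding eq by (intro order_trans[OF norm_triangle_ineq] add_mono b1 b2 b5)
    then show "norm ((K - 2) * (w * star w)) \<le> 1 / 10"
      by (simp add: q_def)
  next
    fix T S assume "self_adjoint T" "norm (y - T) \<le> 20" "norm (T * S - 1) < 1"
    then show thesis unfolding y_def by (rule that)
  qed
qed

section \<open>Assembling the two splittings\<close>

text \<open>The equation holds on all elements z x z and is a closed condition.\<close>

lemma hereditary_subalgebra_unit: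
  assumes a: "a * z = z" and q: "q \<in> hereditary_subalgebra z"
  shows "a * q = q"
proof -
  have "closed {q. a * q = q}" by (intro closed_Collect_eq continuous_intros)
  moreover have "{z * x * z | x. True} \<subseteq> {q. a * q = q}"
    by (auto simp: mult.assoc[symmetric] a)
  ultimately have "hereditary_subalgebra z \<subseteq> {q. a * q = q}"
    unfolding hereditary_subalgebra_def by (intro closure_minimal)
  with q show ?thesis by blast
qed

text \<open>Constant sequences of nonzero squares are the elements at which the splitting property
  is applied.\<close>

lemma const_seq_square_in_ainf_pp:
  assumes "self_adjoint a" "a \<noteq> 0"
  shows "const_seq (a * a) \<in> ainf_pp" "const_seq (a * a) \<noteq> 0"
proof -
  have "a * a \<noteq> 0" using assms norm_self_adjoint_square[of a] by auto
  then have n: "\<not> has_null_subseq (const_seq (a * a))" by (simp add: has_null_subseq_const_seq)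
  moreover have "const_seq (a * a) = star (const_seq a) * const_seq a"
    using assms(1) by (simp add: const_seq_mult const_seq_star[symmetric] self_adjoint_def)
  ultimately show "const_seq (a * a) \<in> ainf_pp" by (auto simp: ainf_pp_def positive_cone_def)
  show "const_seq (a * a) \<noteq> 0"
    using n has_null_subseq_const_seq[of "0 :: 'a"] by (auto simp: const_seq_zero)
qed

lemma invertible_at_bounded_distance:
  fixes \<phi> :: "'a::unital_cstar_algebra \<Rightarrow> 'b::unital_cstar_algebra"
  assumes simple: "simple_cstar TYPE('a)" and tss: "tracially_sequentially_split \<phi>"
    and \<phi>1: "\<phi> 1 = 1" and rr: "real_rank_zero TYPE('b)" and x0: "self_adjoint (x0 :: 'a)"
  obtains y where "self_adjoint y" "invertible_element y" "norm (x0 - y) < 22"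
proof (cases "invertible_element x0")
  case True
  then show thesis using x0 by (intro that[of x0]) auto
next
  case False
  then obtain x z where x: "self_adjoint x" "norm (x0 - x) \<le> 1" and z: "self_adjoint z" "z \<noteq> 0"
    and xz: "x * z = 0"
    using annihilated_perturbation[OF x0] by metis
  have split: "\<exists>\<psi> g v. star_hom \<psi> \<and> projection g \<and> g \<noteq> 0 \<and> g \<in> central_sequences \<and>
        (\<forall>a. \<psi> (\<phi> a) = const_seq a * g) \<and> star v * v = 1 - g \<and> projection (v * star v) \<and>
        v * star v \<in> hereditary_subalgebra (const_seq (a * a))"
    if "self_adjoint a" "a \<noteq> 0" for a :: 'a
    using tss const_seq_square_in_ainf_pp[OF that]
    unfolding tracially_sequentially_split_def mvn_equivalent_def by blast
  have "\<phi> (star x) = star (\<phi> x)" using tss by (simp add: tracially_sequentially_split_def star_hom_def)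
  then have "self_adjoint (\<phi> x)" using x by (simp add: self_adjoint_def)
  then obtain k j N where k: "self_adjoint k" "k * j = 1" "norm j \<le> 1" "norm (k - \<phi> x) \<le> 3"
    "norm N \<le> 3" "norm (k - 2 - N * \<phi> x) \<le> 1 / 100"
    using invertible_perturbation[OF rr, of "\<phi> x" "1 / 100" thesis] by simp
  obtain \<psi>1 :: "'b \<Rightarrow> 'a ainf" and g1
    where g1: "star_hom \<psi>1" "projection g1" "g1 \<noteq> 0" "g1 \<in> central_sequences"
      "\<And>a. \<psi>1 (\<phi> a) = const_seq a * g1"
    using split[OF self_adjoint_one] by auto
  obtain \<nu> where \<nu>: "0 < \<nu>"
    and approx: "\<And>\<theta>. 0 < \<theta> \<Longrightarrow> \<exists>p c e M. projection p \<and> self_adjoint c \<and> p * c = c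
      \<and> norm (c * e - p) < \<theta> \<and> norm e < 2 \<and> norm (c - x * p) < 4 \<and> norm M < 4
      \<and> norm (c - 2 * p - M * x) < 2 * (1 / 100) \<and> norm (p * x - x * p) < \<theta> \<and> \<nu> < norm (p * z * p)"
    using split_corner_approximation[OF simple g1 \<phi>1 z(2) k, of thesis] by auto
  \<comment> \<open>The second term makes \<theta> |z|^2 / \<nu>^2 at most 1 / 200; this quantity
    bounds x R b^2 below.\<close>
  define \<theta> where "\<theta> = min (1 / 100) (\<nu>\<^sup>2 / (200 * ((norm z)\<^sup>2 + 1)))"
  have z1: "(norm z)\<^sup>2 + 1 > 0" by (simp add: add_nonneg_pos)
  then have \<theta>: "0 < \<theta>" "\<theta> \<le> 1 / 100"
    using \<nu> by (simp add: \<theta>_def) (simp only: \<theta>_def min.cobounded1)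
  have "\<theta> \<le> \<nu>\<^sup>2 / (200 * ((norm z)\<^sup>2 + 1))" by (simp only: \<theta>_def min.cobounded2)
  then have "\<theta> * ((norm z)\<^sup>2 + 1) \<le> \<nu>\<^sup>2 / 200" using z1 by (simp add: field_simps)
  then have \<theta>z: "\<theta> * (norm z)\<^sup>2 \<le> \<nu>\<^sup>2 / 200" using \<theta> by (simp add: distrib_left)
  obtain p c e M where p: "projection p" and c: "self_adjoint c" "p * c = c" and e: "norm e < 2"
    and ce: "norm (c * e - p) < \<theta>" and cx: "norm (c - x * p) < 4"
    and M: "norm M < 4" and cM: "norm (c - 2 * p - M * x) < 2 * (1 / 100)"
    and px: "norm (p * x - x * p) < \<theta>" and pzp: "\<nu> < norm (p * z * p)"
    using approx[OF \<theta>(1)] by blast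
  have pp: "p * p = p" and sp: "star p = p" using p by (auto simp: projection_def self_adjoint_def)
  define b where "b = p * z * p"
  have b: "self_adjoint b" using z(1) by (simp add: b_def self_adjoint_def star_mult sp mult.assoc)
  have pb: "p * b = b" and bp: "b * p = b" by (simp_all add: b_def mult.assoc pp)
    (simp add: mult.assoc[symmetric] pp)
  have nb: "norm b \<le> norm z" unfolding b_def by (rule norm_mult_projections_le[OF p p])
  have "\<nu>\<^sup>2 < norm (b * b)"
    using pzp \<nu> by (simp add: norm_self_adjoint_square[OF b] b_def[symmetric] power_strict_mono)
  \<comment> \<open>Cutting b^2 at level \<nu>^2 gives a nonzero \<open>t\<close> on which R b^2 is
    a left unit, with \<open>R\<close> bounded in terms of \<nu>. As \<open>b\<close> lies in the
    corner of \<open>p\<close>, this puts \<open>t\<close> under \<open>p\<close>.\<close>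
  then obtain t R where t: "self_adjoint t" "t \<noteq> 0" and R: "R * (b * b) * t = t" "norm R \<le> 1 / \<nu>\<^sup>2"
      "\<And>c. c * (b * b) = b * b * c \<Longrightarrow> c * R = R * c"
    using cut_down[OF psd_square[OF b], of "\<nu>\<^sup>2"] \<nu> by auto
  have pR: "p * R = R * p" by (rule R(3)) (metis pb bp mult.assoc)
  have bR: "b * b * R = R * (b * b)" by (rule R(3)) simp
  obtain \<psi> :: "'b \<Rightarrow> 'a ainf" and g v
    where g: "star_hom \<psi>" "projection g" "g \<in> central_sequences"
      "\<And>a. \<psi> (\<phi> a) = const_seq a * g"
      and v: "star v * v = 1 - g" and q: "projection (v * star v)"
      and her: "v * star v \<in> hereditary_subalgebra (const_seq (t * t))"
    using split[OF t] by blast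
  have "const_seq (R * (b * b)) * const_seq (t * t) = const_seq (t * t)"
    by (simp add: const_seq_mult[symmetric] mult.assoc[symmetric]) (metis R(1) mult.assoc)
  from hereditary_subalgebra_unit[OF this her]
  have Rq: "const_seq (R * (b * b)) * (v * star v) = v * star v" .
  have "p * (R * (b * b)) = R * (b * b)" by (metis pR pb mult.assoc)
  then have pq: "const_seq p * (v * star v) = v * star v"
    by (metis Rq const_seq_mult mult.assoc)
  \<comment> \<open>From x z = 0, only the commutator of \<open>x\<close> and \<open>p\<close>
    survives.\<close>
  have "x * b = (x * p - p * x) * (z * p)"
    using arg_cong[OF xz, of "\<lambda>a. p * a * p"] by (simp add: b_def algebra_simps)
  then have "x * (R * (b * b)) = ((x * p - p * x) * z) * (p * b) * R"
    by (metis bR mult.assoc)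
  also have "norm \<dots> \<le> \<theta> * norm z * norm z * (1 / \<nu>\<^sup>2)"
    using px nb R(2) by (intro norm_mult_le) (auto simp: norm_minus_commute pb)
  also have "\<dots> \<le> 1 / 200" using \<theta>z \<nu> by (simp add: field_simps power2_eq_square)
  finally have "norm (const_seq (x * (R * (b * b)))) \<le> 1 / 200"
    using norm_const_seq_le order_trans by blast
  then have "norm (const_seq (x * (R * (b * b))) * (v * star v)) \<le> 1 / 200 * 1"
    by (intro norm_mult_le norm_projection_le q)
  then have xq: "norm (const_seq x * (v * star v)) \<le> 1 / 200"
    by (simp only: const_seq_mult[of x] mult.assoc[of "const_seq x"] Rq mult_1_right)
  have small: "norm (c * e - p) \<le> 1 / 100" "norm (p * x - x * p) \<le> 1 / 100"
      "norm (c - 2 * p - M * x) \<le> 1 / 50"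
    using ce px \<theta>(2) cM by linarith+
  obtain T S where T: "self_adjoint T" "norm (const_seq x - T) \<le> 20" "norm (T * S - 1) < 1"
    by (rule split_perturbation[OF g \<phi>1 x(1) k p c less_imp_le[OF e] small(1)
          less_imp_le[OF cx] less_imp_le[OF M] small(3,2) v q pq xq])
  \<comment> \<open>The bound 20 is enlarged to 21 to be strict; the passage from \<open>x0\<close>
    to \<open>x\<close> costs 1 more.\<close>
  then obtain y where y: "self_adjoint y" "invertible_element y" "norm (x - y) < 21"
    using lift_invertible[OF T(1), of x 21 S] by auto
  have "norm (x0 - y) \<le> norm (x0 - x) + norm (x - y)"
    using norm_triangle_ineq[of "x0 - x" "x - y"] by simp
  then show thesis using x(2) y by (intro that[of y]) auto
qed

theorem theorem2p13:
  fixes \<phi> :: "'a::unital_cstar_algebra \<Rightarrow> 'b::unital_cstar_algebra"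
  assumes "separable_cstar TYPE('a)" and "simple_cstar TYPE('a)"
    and "separable_cstar TYPE('b)" and "simple_cstar TYPE('b)"
    and "tracially_sequentially_split \<phi>" and "\<phi> 1 = 1"
    and "real_rank_zero TYPE('b)"
  shows "real_rank_zero TYPE('a)"
  unfolding real_rank_zero_def
proof (intro subsetI, unfold closure_approachable, intro allI impI)
  fix x :: 'a and \<epsilon> :: real
  assume "x \<in> {x. self_adjoint x}" and \<epsilon>: "0 < \<epsilon>"
  \<comment> \<open>Scaling back by \<epsilon> / 22 turns distance below 22 into distance below
    \<epsilon>.\<close>
  then have "self_adjoint ((22 / \<epsilon>) *\<^sub>R x)" by (simp add: self_adjoint_scaleR)
  from invertible_at_bounded_distance[OF assms(2,5,6,7) this]
  obtain y where y: "self_adjoint y" "invertible_element y" "norm ((22 / \<epsilon>) *\<^sub>R x - y) < 22"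
    by metis
  have "(\<epsilon> / 22) *\<^sub>R y - x = (\<epsilon> / 22) *\<^sub>R (y - (22 / \<epsilon>) *\<^sub>R x)"
    using \<epsilon> by (simp add: scaleR_diff_right)
  then have "norm ((\<epsilon> / 22) *\<^sub>R y - x) = \<epsilon> / 22 * norm ((22 / \<epsilon>) *\<^sub>R x - y)"
    using \<epsilon> by (simp add: norm_minus_commute)
  also have "\<dots> < \<epsilon> / 22 * 22" using y(3) \<epsilon> by (intro mult_strict_left_mono) simp_all
  finally have "dist ((\<epsilon> / 22) *\<^sub>R y) x < \<epsilon>" by (simp add: dist_norm)
  moreover obtain d where "y * d = 1" "d * y = 1" using y(2) by (auto simp: invertible_element_def)
  then have "(\<epsilon> / 22) *\<^sub>R y * ((22 / \<epsilon>) *\<^sub>R d) = 1" "(22 / \<epsilon>) *\<^sub>R d * ((\<epsilon> / 22) *\<^sub>R y) = 1"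
    using \<epsilon> by simp_all
  then have "invertible_element ((\<epsilon> / 22) *\<^sub>R y)" unfolding invertible_element_def by blast
  moreover have "self_adjoint ((\<epsilon> / 22) *\<^sub>R y)" by (rule self_adjoint_scaleR[OF y(1)])
  ultimately show "\<exists>y\<in>{x. self_adjoint x \<and> invertible_element x}. dist y x < \<epsilon>" by blast
qed

end
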